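(* Let $\mathcal D,\mathcal X,\mathcal Y$ be triangulated categories and let $\mathcal R$ be a recollement of $\mathcal D$ by $\mathcal X$ and $\mathcal Y$ with functors $i^*,i_*,i^!,j_!,j^*,j_*$. Let $X$ and $Y$ be silting objects of $\mathcal X$ and $\mathcal Y$, corresponding to the co-t-structures $(\mathcal X_{\geq 0},\mathcal X_{\leq 0})$ in $\mathcal X$ and $(\mathcal Y_{\geq 0},\mathcal Y_{\leq 0})$ in $\mathcal Y$, respectively. Let $(\mathcal D_{\geq 0},\mathcal D_{\leq 0})$ be the co-t-structure in $\mathcal D$ glued from these two along $\mathcal R$. Let $\beta_{\geq 1}i^!j_!X\to i^!j_!X$ be a (non-functorial) choice of truncation for $(\mathcal Y_{\geq 0},\mathcal Y_{\leq 0})$, and define $K_X$ by the triangle $$i_*\beta_{\geq 1}i^!j_!X\longrightarrow j_!X\longrightarrow K_X\longrightarrow (i_*\beta_{\geq 1}i^!j_!X)[1],$$ whose first morphism corresponds to the chosen morphism $\beta_{\geq 1}i^!j_!X\to i^!j_!X$ under the adjunction $(i_*,i^!)$. Then $Z=i_*Y\oplus K_X$ is a silting object of $\mathcal D$, and the co-t-structure in $\mathcal D$ associated with $Z$ is the glued co-t-structure $(\mathcal D_{\geq 0},\mathcal D_{\leq 0})$.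
   Context: A recollement of a triangulated category $\mathcal D$ by triangulated categories $\mathcal X$ and $\mathcal Y$ consists of six triangle functors $i^*,i^!:\mathcal D\to\mathcal Y$, $i_*:\mathcal Y\to\mathcal D$, $j^*:\mathcal D\to\mathcal X$, $j_!,j_*:\mathcal X\to\mathcal D$ such that: (1) $(i^*,i_* )$, $(i_*,i^!)$, $(j_!,j^* )$, $(j^*,j_* )$ are adjoint pairs; (2) $i_*,j_*,j_!$ are fully faithful; (3) $i^!j_*=0$; (4) for each $Z\in\mathcal D$ the units and counits of the adjunctions yield triangles $i_*i^!Z\to Z\to j_*j^*Z\to i_*i^!Z[1]$ and $j_!j^*Z\to Z\to i_*i^*Z\to j_!j^*Z[1]$. A torsion pair in $\mathcal D$ is a pair $(\mathcal D',\mathcal D'')$ of strict full subcategories, closed under direct summands and (finite) direct sums, with $\mathrm{Hom}_{\mathcal D}(U,V)=0$ for all $U\in\mathcal D'$, $V\in\mathcal D''$, and such that every $W\in\mathcal D$ lies in a triangle $U\to W\to V\to U[1]$ with $U\in\mathcal D'$, $V\in\mathcal D''$. A co-t-structure is a pair $(\mathcal D_{\geq 0},\mathcal D_{\leq 0})$ such that, writing $\mathcal D_{\geq n}=\mathcal D_{\geq 0}[-n]$ and $\mathcal D_{\leq n}=\mathcal D_{\leq 0}[-n]$, the pair $(\mathcal D_{\geq 0},\mathcal D_{\leq -1})$ is a torsion pair and $\mathcal D_{\geq 0}\subseteq\mathcal D_{\geq -1}$. For an object $W$, a choice of triangle $\beta_{\geq n}W\to W\to\beta_{\leq n-1}W\to(\beta_{\geq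 n}W)[1]$ with $\beta_{\geq n}W\in\mathcal D_{\geq n}$ and $\beta_{\leq n-1}W\in\mathcal D_{\leq n-1}$ is called a (non-functorial) choice of truncation. The co-heart is $\mathcal D_{\geq 0}\cap\mathcal D_{\leq 0}$. An object $M$ of $\mathcal D$ is silting if $\mathrm{Hom}_{\mathcal D}(M,M[i])=0$ for all $i>0$ and $\mathcal D$ is the smallest triangulated subcategory containing $M$ and closed under direct summands, extensions and shifts. The co-t-structure associated with (corresponding to) a silting object $M$ is: $\mathcal D_{\geq 0}$ (resp. $\mathcal D_{\leq 0}$) is the smallest full subcategory closed under direct summands, direct sums and extensions containing $\{M[i]: i\leq 0\}$ (resp. $\{M[i]:i\geq 0\}$). Its co-heart is $\mathrm{add}(M)$; this gives a bijection between silting objects up to $\mathrm{add}$-equivalence and bounded co-t-structures whose co-heart is additively generated by one object. The co-t-structure glued along a recollement from co-t-structures in $\mathcal X$ and $\mathcal Y$ is $\mathcal D_{\geq 0}=\{W\in\mathcal D: j^*W\in\mathcal X_{\geq 0},\ i^*W\in\mathcal Y_{\geq 0}\}$, $\mathcal D_{\leq 0}=\{W\in\mathcal D: j^*W\in\mathcal X_{\leq 0},\ i^!W\in\mathcal Y_{\leq 0}\}$. *)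

theory Defs
  imports Main "HOL-Algebra.Group"
begin

section \<open>Categories\<close>

record ('o, 'm) category =
  Obj :: "'o set"
  Arr :: "'m set"
  Dom :: "'m \<Rightarrow> 'o"
  Cod :: "'m \<Rightarrow> 'o"
  Id :: "'o \<Rightarrow> 'm"
  Comp :: "'m \<Rightarrow> 'm \<Rightarrow> 'm" (infixl "\<cdot>\<index>" 70)

definition hom_set :: "('o, 'm, 'z) category_scheme \<Rightarrow> 'o \<Rightarrow> 'o \<Rightarrow> 'm set" where
  "hom_set C A B = {f \<in> Arr C. Dom C f = A \<and> Cod C f = B}"

locale category =
  fixes C (structure)
  assumes Dom_Obj: "f \<in> Arr C \<Longrightarrow> Dom C f \<in> Obj C"
    and Cod_Obj: "f \<in> Arr C \<Longrightarrow> Cod C f \<in> Obj C"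
    and Id_hom: "A \<in> Obj C \<Longrightarrow> Id C A \<in> hom_set C A A"
    and Comp_hom: "\<lbrakk>f \<in> hom_set C A B; g \<in> hom_set C B E\<rbrakk> \<Longrightarrow> g \<cdot> f \<in> hom_set C A E"
    and Comp_assoc: "\<lbrakk>f \<in> hom_set C A B; g \<in> hom_set C B E; h \<in> hom_set C E F\<rbrakk>
          \<Longrightarrow> (h \<cdot> g) \<cdot> f = h \<cdot> (g \<cdot> f)"
    and Comp_Id_right: "f \<in> hom_set C A B \<Longrightarrow> f \<cdot> Id C A = f"
    and Comp_Id_left: "f \<in> hom_set C A B \<Longrightarrow> Id C B \<cdot> f = f"

definition is_iso :: "('o, 'm, 'z) category_scheme \<Rightarrow> 'm \<Rightarrow> bool" where
  "is_iso C f \<longleftrightarrow> f \<in> Arr C \<and>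
     (\<exists>g \<in> hom_set C (Cod C f) (Dom C f).
        g \<cdot>\<^bsub>C\<^esub> f = Id C (Dom C f) \<and> f \<cdot>\<^bsub>C\<^esub> g = Id C (Cod C f))"

definition isomorphic :: "('o, 'm, 'z) category_scheme \<Rightarrow> 'o \<Rightarrow> 'o \<Rightarrow> bool" where
  "isomorphic C A B \<longleftrightarrow> (\<exists>f \<in> hom_set C A B. is_iso C f)"

definition zero_object :: "('o, 'm, 'z) category_scheme \<Rightarrow> 'o \<Rightarrow> bool" where
  "zero_object C A \<longleftrightarrow> A \<in> Obj C \<and>
     (\<forall>B \<in> Obj C. (\<exists>!f. f \<in> hom_set C A B) \<and> (\<exists>!f. f \<in> hom_set C B A))"

section \<open>Additive categories\<close>

record ('o, 'm) additive_category = "('o, 'm) category" +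
  Zero :: "'o \<Rightarrow> 'o \<Rightarrow> 'm"
  Add :: "'m \<Rightarrow> 'm \<Rightarrow> 'm"

definition hom_group :: "('o, 'm, 'z) additive_category_scheme \<Rightarrow> 'o \<Rightarrow> 'o \<Rightarrow> 'm monoid" where
  "hom_group C A B = \<lparr>carrier = hom_set C A B, mult = Add C, one = Zero C A B\<rparr>"

definition Neg :: "('o, 'm, 'z) additive_category_scheme \<Rightarrow> 'm \<Rightarrow> 'm" where
  "Neg C f = inv\<^bsub>hom_group C (Dom C f) (Cod C f)\<^esub> f"

definition is_biproduct ::
  "('o, 'm, 'z) additive_category_scheme \<Rightarrow> 'o \<Rightarrow> 'o \<Rightarrow> 'o \<Rightarrow> 'm \<Rightarrow> 'm \<Rightarrow> 'm \<Rightarrow> 'm \<Rightarrow> bool" where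
  "is_biproduct C A B S i1 i2 p1 p2 \<longleftrightarrow>
     A \<in> Obj C \<and> B \<in> Obj C \<and> S \<in> Obj C \<and>
     i1 \<in> hom_set C A S \<and> i2 \<in> hom_set C B S \<and> p1 \<in> hom_set C S A \<and> p2 \<in> hom_set C S B \<and>
     p1 \<cdot>\<^bsub>C\<^esub> i1 = Id C A \<and> p2 \<cdot>\<^bsub>C\<^esub> i2 = Id C B \<and>
     p2 \<cdot>\<^bsub>C\<^esub> i1 = Zero C A B \<and> p1 \<cdot>\<^bsub>C\<^esub> i2 = Zero C B A \<and>
     Add C (i1 \<cdot>\<^bsub>C\<^esub> p1) (i2 \<cdot>\<^bsub>C\<^esub> p2) = Id C S"

definition is_direct_sum :: "('o, 'm, 'z) additive_category_scheme \<Rightarrow> 'o \<Rightarrow> 'o \<Rightarrow> 'o \<Rightarrow> bool" where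
  "is_direct_sum C A B S \<longleftrightarrow> (\<exists>i1 i2 p1 p2. is_biproduct C A B S i1 i2 p1 p2)"

locale additive_category = category C
  for C :: "('o, 'm, 'z) additive_category_scheme" (structure) +
  assumes hom_comm_group:
      "\<lbrakk>A \<in> Obj C; B \<in> Obj C\<rbrakk> \<Longrightarrow> comm_group (hom_group C A B)"
    and Comp_Add_left: "\<lbrakk>f \<in> hom_set C A B; g \<in> hom_set C B E; g' \<in> hom_set C B E\<rbrakk>
          \<Longrightarrow> Add C g g' \<cdot> f = Add C (g \<cdot> f) (g' \<cdot> f)"
    and Comp_Add_right: "\<lbrakk>f \<in> hom_set C A B; f' \<in> hom_set C A B; g \<in> hom_set C B E\<rbrakk>
          \<Longrightarrow> g \<cdot> Add C f f' = Add C (g \<cdot> f) (g \<cdot> f')"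
    and ex_zero_object: "\<exists>A. zero_object C A"
    and ex_direct_sum: "\<lbrakk>A \<in> Obj C; B \<in> Obj C\<rbrakk> \<Longrightarrow> \<exists>S. is_direct_sum C A B S"

section \<open>Functors and adjunctions\<close>

record ('o1, 'm1, 'o2, 'm2) functor_data =
  FObj :: "'o1 \<Rightarrow> 'o2"
  FMor :: "'m1 \<Rightarrow> 'm2"

locale is_functor =
  fixes C :: "('o1, 'm1, 'z1) category_scheme"
    and D :: "('o2, 'm2, 'z2) category_scheme"
    and F :: "('o1, 'm1, 'o2, 'm2, 'z3) functor_data_scheme"
  assumes FObj_Obj: "A \<in> Obj C \<Longrightarrow> FObj F A \<in> Obj D"
    and FMor_hom: "f \<in> hom_set C A B \<Longrightarrow> FMor F f \<in> hom_set D (FObj F A) (FObj F B)"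
    and FMor_Id: "A \<in> Obj C \<Longrightarrow> FMor F (Id C A) = Id D (FObj F A)"
    and FMor_Comp: "\<lbrakk>f \<in> hom_set C A B; g \<in> hom_set C B E\<rbrakk>
          \<Longrightarrow> FMor F (g \<cdot>\<^bsub>C\<^esub> f) = FMor F g \<cdot>\<^bsub>D\<^esub> FMor F f"

locale additive_functor = is_functor C D F
  for C :: "('o1, 'm1, 'z1) additive_category_scheme"
    and D :: "('o2, 'm2, 'z2) additive_category_scheme"
    and F :: "('o1, 'm1, 'o2, 'm2, 'z3) functor_data_scheme" +
  assumes FMor_Add: "\<lbrakk>f \<in> hom_set C A B; g \<in> hom_set C A B\<rbrakk>
          \<Longrightarrow> FMor F (Add C f g) = Add D (FMor F f) (FMor F g)"

definition fully_faithful ::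
  "('o1, 'm1, 'z1) category_scheme \<Rightarrow> ('o2, 'm2, 'z2) category_scheme \<Rightarrow>
   ('o1, 'm1, 'o2, 'm2, 'z3) functor_data_scheme \<Rightarrow> bool" where
  "fully_faithful C D F \<longleftrightarrow>
     (\<forall>A \<in> Obj C. \<forall>B \<in> Obj C.
        bij_betw (FMor F) (hom_set C A B) (hom_set D (FObj F A) (FObj F B)))"

text \<open>\<open>L : C \<rightarrow> D\<close> is left adjoint to \<open>R : D \<rightarrow> C\<close>, with unit \<open>\<eta> : 1 \<rightarrow> R L\<close> and counit
  \<open>\<epsilon> : L R \<rightarrow> 1\<close>.\<close>

locale adjoint_pair =
  fixes C :: "('o1, 'm1, 'z1) category_scheme"
    and D :: "('o2, 'm2, 'z2) category_scheme"
    and L :: "('o1, 'm1, 'o2, 'm2, 'z3) functor_data_scheme"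
    and R :: "('o2, 'm2, 'o1, 'm1, 'z4) functor_data_scheme"
    and \<eta> :: "'o1 \<Rightarrow> 'm1"
    and \<epsilon> :: "'o2 \<Rightarrow> 'm2"
  assumes left_functor: "is_functor C D L"
    and right_functor: "is_functor D C R"
    and unit_hom: "A \<in> Obj C \<Longrightarrow> \<eta> A \<in> hom_set C A (FObj R (FObj L A))"
    and counit_hom: "B \<in> Obj D \<Longrightarrow> \<epsilon> B \<in> hom_set D (FObj L (FObj R B)) B"
    and unit_natural: "f \<in> hom_set C A A' \<Longrightarrow> \<eta> A' \<cdot>\<^bsub>C\<^esub> f = FMor R (FMor L f) \<cdot>\<^bsub>C\<^esub> \<eta> A"
    and counit_natural: "g \<in> hom_set D B B' \<Longrightarrow> g \<cdot>\<^bsub>D\<^esub> \<epsilon> B = \<epsilon> B' \<cdot>\<^bsub>D\<^esub> FMor L (FMor R g)"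
    and zigzag_left: "A \<in> Obj C \<Longrightarrow> \<epsilon> (FObj L A) \<cdot>\<^bsub>D\<^esub> FMor L (\<eta> A) = Id D (FObj L A)"
    and zigzag_right: "B \<in> Obj D \<Longrightarrow> FMor R (\<epsilon> B) \<cdot>\<^bsub>C\<^esub> \<eta> (FObj R B) = Id C (FObj R B)"

text \<open>The morphism \<open>L A \<rightarrow> B\<close> of \<open>D\<close> corresponding to \<open>f : A \<rightarrow> R B\<close> under the adjunction with
  counit \<open>\<epsilon>\<close>. The object \<open>B\<close> has to be given, since it is not determined by \<open>f\<close>.\<close>

definition adjunct ::
  "('o2, 'm2, 'z2) category_scheme \<Rightarrow> ('o1, 'm1, 'o2, 'm2, 'z3) functor_data_scheme \<Rightarrow>
   ('o2 \<Rightarrow> 'm2) \<Rightarrow> 'o2 \<Rightarrow> 'm1 \<Rightarrow> 'm2" where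
  "adjunct D L \<epsilon> B f = \<epsilon> B \<cdot>\<^bsub>D\<^esub> FMor L f"

section \<open>Triangulated categories\<close>

text \<open>\<open>Tri\<close> is the class of distinguished triangles \<open>A \<rightarrow> B \<rightarrow> C \<rightarrow> A[1]\<close>, each given by its three
  morphisms.\<close>

record ('o, 'm) triangulated_category = "('o, 'm) additive_category" +
  Shift :: "'o \<Rightarrow> 'o"
  ShiftMor :: "'m \<Rightarrow> 'm"
  Tri :: "('m \<times> 'm \<times> 'm) set"

definition shift_functor ::
  "('o, 'm, 'z) triangulated_category_scheme \<Rightarrow> ('o, 'm, 'o, 'm) functor_data" where
  "shift_functor T = \<lparr>FObj = Shift T, FMor = ShiftMor T\<rparr>"

definition candidate_triangle ::
  "('o, 'm, 'z) triangulated_category_scheme \<Rightarrow> 'm \<Rightarrow> 'm \<Rightarrow> 'm \<Rightarrow> bool" where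
  "candidate_triangle T f g h \<longleftrightarrow>
     f \<in> Arr T \<and> g \<in> Arr T \<and> h \<in> Arr T \<and>
     Cod T f = Dom T g \<and> Cod T g = Dom T h \<and> Cod T h = Shift T (Dom T f)"

definition triangle_morphism ::
  "('o, 'm, 'z) triangulated_category_scheme \<Rightarrow> 'm \<times> 'm \<times> 'm \<Rightarrow> 'm \<times> 'm \<times> 'm \<Rightarrow>
   'm \<Rightarrow> 'm \<Rightarrow> 'm \<Rightarrow> bool" where
  "triangle_morphism T t t' a b c \<longleftrightarrow> (case t of (f, g, h) \<Rightarrow> case t' of (f', g', h') \<Rightarrow>
     a \<in> hom_set T (Dom T f) (Dom T f') \<and>
     b \<in> hom_set T (Dom T g) (Dom T g') \<and>
     c \<in> hom_set T (Dom T h) (Dom T h') \<and>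
     f' \<cdot>\<^bsub>T\<^esub> a = b \<cdot>\<^bsub>T\<^esub> f \<and> g' \<cdot>\<^bsub>T\<^esub> b = c \<cdot>\<^bsub>T\<^esub> g \<and> h' \<cdot>\<^bsub>T\<^esub> c = ShiftMor T a \<cdot>\<^bsub>T\<^esub> h)"

text \<open>Following Verdier, the shift is an automorphism, not merely an autoequivalence, so
  that \<open>A[n]\<close> makes sense on the nose for every integer \<open>n\<close>.\<close>

locale triangulated_category = additive_category T
  for T :: "('o, 'm, 'z) triangulated_category_scheme" (structure) +
  assumes shift_additive: "additive_functor T T (shift_functor T)"
    and Shift_bij: "bij_betw (Shift T) (Obj T) (Obj T)"
    and ShiftMor_bij: "bij_betw (ShiftMor T) (Arr T) (Arr T)"
    and Tri_candidate: "(f, g, h) \<in> Tri T \<Longrightarrow> candidate_triangle T f g h"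
    and Tri_iso: "\<lbrakk>(f, g, h) \<in> Tri T; candidate_triangle T f' g' h';
            triangle_morphism T (f, g, h) (f', g', h') a b c;
            is_iso T a; is_iso T b; is_iso T c\<rbrakk> \<Longrightarrow> (f', g', h') \<in> Tri T"
    and Tri_Id: "\<lbrakk>A \<in> Obj T; zero_object T N\<rbrakk>
            \<Longrightarrow> (Id T A, Zero T A N, Zero T N (Shift T A)) \<in> Tri T"
    and Tri_complete: "f \<in> Arr T \<Longrightarrow> \<exists>g h. (f, g, h) \<in> Tri T"
    and Tri_rotate: "candidate_triangle T f g h
            \<Longrightarrow> (f, g, h) \<in> Tri T \<longleftrightarrow> (g, h, Neg T (ShiftMor T f)) \<in> Tri T"
    and Tri_morphism: "\<lbrakk>(f, g, h) \<in> Tri T; (f', g', h') \<in> Tri T;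
            a \<in> hom_set T (Dom T f) (Dom T f'); b \<in> hom_set T (Dom T g) (Dom T g');
            f' \<cdot> a = b \<cdot> f\<rbrakk> \<Longrightarrow> \<exists>c. triangle_morphism T (f, g, h) (f', g', h') a b c"
    and Tri_octahedral: "\<lbrakk>Cod T f = Dom T g; (f, f', f'') \<in> Tri T; (g, g', g'') \<in> Tri T;
            (g \<cdot> f, h', h'') \<in> Tri T\<rbrakk> \<Longrightarrow>
            \<exists>u v. (u, v, ShiftMor T f' \<cdot> g'') \<in> Tri T \<and>
              u \<in> hom_set T (Cod T f') (Cod T h') \<and> v \<in> hom_set T (Cod T h') (Cod T g') \<and>
              u \<cdot> f' = h' \<cdot> g \<and> h'' \<cdot> u = f'' \<and>
              v \<cdot> h' = g' \<and> g'' \<cdot> v = ShiftMor T f \<cdot> h''"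

definition shift_by :: "('o, 'm, 'z) triangulated_category_scheme \<Rightarrow> int \<Rightarrow> 'o \<Rightarrow> 'o" where
  "shift_by T n A = (if n \<ge> 0 then (Shift T ^^ nat n) A
                     else (inv_into (Obj T) (Shift T) ^^ nat (- n)) A)"

text \<open>A triangle functor is a functor together with a natural isomorphism \<open>F(A[1]) \<cong> F(A)[1]\<close>,
  here \<open>FShift F\<close>.\<close>

record ('o1, 'm1, 'o2, 'm2) triangle_functor = "('o1, 'm1, 'o2, 'm2) functor_data" +
  FShift :: "'o1 \<Rightarrow> 'm2"

locale triangle_functor = additive_functor C D F
  for C :: "('o1, 'm1, 'z1) triangulated_category_scheme"
    and D :: "('o2, 'm2, 'z2) triangulated_category_scheme"
    and F :: "('o1, 'm1, 'o2, 'm2, 'z3) triangle_functor_scheme" +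
  assumes FShift_hom:
      "A \<in> Obj C \<Longrightarrow> FShift F A \<in> hom_set D (FObj F (Shift C A)) (Shift D (FObj F A))"
    and FShift_iso: "A \<in> Obj C \<Longrightarrow> is_iso D (FShift F A)"
    and FShift_natural: "f \<in> hom_set C A B \<Longrightarrow>
          FShift F B \<cdot>\<^bsub>D\<^esub> FMor F (ShiftMor C f) = ShiftMor D (FMor F f) \<cdot>\<^bsub>D\<^esub> FShift F A"
    and FMor_Tri: "(f, g, h) \<in> Tri C \<Longrightarrow>
          (FMor F f, FMor F g, FShift F (Dom C f) \<cdot>\<^bsub>D\<^esub> FMor F h) \<in> Tri D"

section \<open>Full subcategories\<close>

text \<open>Full subcategories are given by their sets of objects.\<close>

definition closed_under_iso :: "('o, 'm, 'z) category_scheme \<Rightarrow> 'o set \<Rightarrow> bool" where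
  "closed_under_iso C S \<longleftrightarrow> (\<forall>A \<in> S. \<forall>B \<in> Obj C. isomorphic C A B \<longrightarrow> B \<in> S)"

definition closed_under_summands :: "('o, 'm, 'z) additive_category_scheme \<Rightarrow> 'o set \<Rightarrow> bool" where
  "closed_under_summands C S \<longleftrightarrow> (\<forall>A B W. is_direct_sum C A B W \<and> W \<in> S \<longrightarrow> A \<in> S)"

text \<open>Finite direct sums, including the empty one.\<close>

definition closed_under_sums :: "('o, 'm, 'z) additive_category_scheme \<Rightarrow> 'o set \<Rightarrow> bool" where
  "closed_under_sums C S \<longleftrightarrow> (\<forall>N. zero_object C N \<longrightarrow> N \<in> S) \<and>
     (\<forall>A \<in> S. \<forall>B \<in> S. \<forall>W. is_direct_sum C A B W \<longrightarrow> W \<in> S)"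

definition closed_under_extensions ::
  "('o, 'm, 'z) triangulated_category_scheme \<Rightarrow> 'o set \<Rightarrow> bool" where
  "closed_under_extensions T S \<longleftrightarrow>
     (\<forall>f g h. (f, g, h) \<in> Tri T \<and> Dom T f \<in> S \<and> Cod T g \<in> S \<longrightarrow> Cod T f \<in> S)"

definition closed_under_shifts ::
  "('o, 'm, 'z) triangulated_category_scheme \<Rightarrow> 'o set \<Rightarrow> bool" where
  "closed_under_shifts T S \<longleftrightarrow> (\<forall>A \<in> S. \<forall>n. shift_by T n A \<in> S)"

definition triangulated_subcategory ::
  "('o, 'm, 'z) triangulated_category_scheme \<Rightarrow> 'o set \<Rightarrow> bool" where
  "triangulated_subcategory T S \<longleftrightarrow> S \<subseteq> Obj T \<and> closed_under_iso T S \<and> closed_under_sums T S \<and>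
     closed_under_shifts T S \<and>
     (\<forall>f g h. (f, g, h) \<in> Tri T \<and> Dom T f \<in> S \<and> Cod T f \<in> S \<longrightarrow> Cod T g \<in> S)"

definition additive_extension_hull ::
  "('o, 'm, 'z) triangulated_category_scheme \<Rightarrow> 'o set \<Rightarrow> 'o set" where
  "additive_extension_hull T G = \<Inter>{S. G \<subseteq> S \<and> S \<subseteq> Obj T \<and>
     closed_under_summands T S \<and> closed_under_sums T S \<and> closed_under_extensions T S}"

definition thick_hull ::
  "('o, 'm, 'z) triangulated_category_scheme \<Rightarrow> 'o set \<Rightarrow> 'o set" where
  "thick_hull T G = \<Inter>{S. G \<subseteq> S \<and> triangulated_subcategory T S \<and>
     closed_under_summands T S \<and> closed_under_extensions T S \<and> closed_under_shifts T S}"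

section \<open>Co-t-structures and silting objects\<close>

definition torsion_pair ::
  "('o, 'm, 'z) triangulated_category_scheme \<Rightarrow> 'o set \<Rightarrow> 'o set \<Rightarrow> bool" where
  "torsion_pair T U V \<longleftrightarrow>
     U \<subseteq> Obj T \<and> closed_under_iso T U \<and> closed_under_summands T U \<and> closed_under_sums T U \<and>
     V \<subseteq> Obj T \<and> closed_under_iso T V \<and> closed_under_summands T V \<and> closed_under_sums T V \<and>
     (\<forall>A \<in> U. \<forall>B \<in> V. hom_set T A B = {Zero T A B}) \<and>
     (\<forall>W \<in> Obj T. \<exists>f g h. (f, g, h) \<in> Tri T \<and> Dom T f \<in> U \<and> Cod T f = W \<and> Cod T g \<in> V)"

text \<open>Pairs \<open>P\<close> below stand for \<open>(\<D>\<^sub>\<ge>\<^sub>0, \<D>\<^sub>\<le>\<^sub>0)\<close>.\<close>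

definition part_ge ::
  "('o, 'm, 'z) triangulated_category_scheme \<Rightarrow> 'o set \<times> 'o set \<Rightarrow> int \<Rightarrow> 'o set" where
  "part_ge T P n = shift_by T (- n) ` fst P"

definition part_le ::
  "('o, 'm, 'z) triangulated_category_scheme \<Rightarrow> 'o set \<times> 'o set \<Rightarrow> int \<Rightarrow> 'o set" where
  "part_le T P n = shift_by T (- n) ` snd P"

definition co_t_structure ::
  "('o, 'm, 'z) triangulated_category_scheme \<Rightarrow> 'o set \<times> 'o set \<Rightarrow> bool" where
  "co_t_structure T P \<longleftrightarrow>
     torsion_pair T (part_ge T P 0) (part_le T P (- 1)) \<and> part_ge T P 0 \<subseteq> part_ge T P (- 1)"

definition truncation_triangle ::
  "('o, 'm, 'z) triangulated_category_scheme \<Rightarrow> 'o set \<times> 'o set \<Rightarrow> int \<Rightarrow> 'o \<Rightarrow>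
   'm \<Rightarrow> 'm \<Rightarrow> 'm \<Rightarrow> bool" where
  "truncation_triangle T P n W f g h \<longleftrightarrow>
     (f, g, h) \<in> Tri T \<and> Dom T f \<in> part_ge T P n \<and> Cod T f = W \<and> Cod T g \<in> part_le T P (n - 1)"

definition silting :: "('o, 'm, 'z) triangulated_category_scheme \<Rightarrow> 'o \<Rightarrow> bool" where
  "silting T M \<longleftrightarrow> M \<in> Obj T \<and>
     (\<forall>i > 0. hom_set T M (shift_by T i M) = {Zero T M (shift_by T i M)}) \<and>
     thick_hull T {M} = Obj T"

definition silting_co_t_structure ::
  "('o, 'm, 'z) triangulated_category_scheme \<Rightarrow> 'o \<Rightarrow> 'o set \<times> 'o set" where
  "silting_co_t_structure T M =
     (additive_extension_hull T {shift_by T i M | i. i \<le> 0},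
      additive_extension_hull T {shift_by T i M | i. i \<ge> 0})"

section \<open>Recollements\<close>

text \<open>The functors are \<open>i\<^sup>*\<close> (\<open>i_star_up\<close>), \<open>i\<^sub>*\<close> (\<open>i_star\<close>), \<open>i\<^sup>!\<close> (\<open>i_shriek_up\<close>), \<open>j\<^sub>!\<close> (\<open>j_shriek\<close>),
  \<open>j\<^sup>*\<close> (\<open>j_star_up\<close>) and \<open>j\<^sub>*\<close> (\<open>j_star\<close>). The units and counits
  of the adjunctions \<open>(i\<^sup>*, i\<^sub>*)\<close>, \<open>(i\<^sub>*, i\<^sup>!)\<close>, \<open>(j\<^sub>!, j\<^sup>*)\<close>, \<open>(j\<^sup>*, j\<^sub>*)\<close> are numbered in this order. They
  are not required to be compatible with the isomorphisms \<open>FShift\<close> of the functors.\<close>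

record ('od, 'md, 'ox, 'mx, 'oy, 'my) recollement =
  i_star_up :: "('od, 'md, 'oy, 'my) triangle_functor"
  i_star :: "('oy, 'my, 'od, 'md) triangle_functor"
  i_shriek_up :: "('od, 'md, 'oy, 'my) triangle_functor"
  j_shriek :: "('ox, 'mx, 'od, 'md) triangle_functor"
  j_star_up :: "('od, 'md, 'ox, 'mx) triangle_functor"
  j_star :: "('ox, 'mx, 'od, 'md) triangle_functor"
  unit1 :: "'od \<Rightarrow> 'md"
  counit1 :: "'oy \<Rightarrow> 'my"
  unit2 :: "'oy \<Rightarrow> 'my"
  counit2 :: "'od \<Rightarrow> 'md"
  unit3 :: "'ox \<Rightarrow> 'mx"
  counit3 :: "'od \<Rightarrow> 'md"
  unit4 :: "'od \<Rightarrow> 'md"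
  counit4 :: "'ox \<Rightarrow> 'mx"

locale recollement =
  D: triangulated_category D + X: triangulated_category X + Y: triangulated_category Y
  for D :: "('od, 'md) triangulated_category"
    and X :: "('ox, 'mx) triangulated_category"
    and Y :: "('oy, 'my) triangulated_category" +
  fixes R :: "('od, 'md, 'ox, 'mx, 'oy, 'my) recollement"
  assumes i_star_up_triangle: "triangle_functor D Y (i_star_up R)"
    and i_star_triangle: "triangle_functor Y D (i_star R)"
    and i_shriek_up_triangle: "triangle_functor D Y (i_shriek_up R)"
    and j_shriek_triangle: "triangle_functor X D (j_shriek R)"
    and j_star_up_triangle: "triangle_functor D X (j_star_up R)"
    and j_star_triangle: "triangle_functor X D (j_star R)"
    and adjoint1: "adjoint_pair D Y (i_star_up R) (i_star R) (unit1 R) (counit1 R)"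
    and adjoint2: "adjoint_pair Y D (i_star R) (i_shriek_up R) (unit2 R) (counit2 R)"
    and adjoint3: "adjoint_pair X D (j_shriek R) (j_star_up R) (unit3 R) (counit3 R)"
    and adjoint4: "adjoint_pair D X (j_star_up R) (j_star R) (unit4 R) (counit4 R)"
    and i_star_ff: "fully_faithful Y D (i_star R)"
    and j_star_ff: "fully_faithful X D (j_star R)"
    and j_shriek_ff: "fully_faithful X D (j_shriek R)"
    and i_shriek_up_j_star: "A \<in> Obj X \<Longrightarrow> zero_object Y (FObj (i_shriek_up R) (FObj (j_star R) A))"
    and triangle_i_j: "W \<in> Obj D \<Longrightarrow> \<exists>h. (counit2 R W, unit4 R W, h) \<in> Tri D"
    and triangle_j_i: "W \<in> Obj D \<Longrightarrow> \<exists>h. (counit3 R W, unit1 R W, h) \<in> Tri D"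

definition glued ::
  "('od, 'md) triangulated_category \<Rightarrow> ('od, 'md, 'ox, 'mx, 'oy, 'my) recollement \<Rightarrow>
   'ox set \<times> 'ox set \<Rightarrow> 'oy set \<times> 'oy set \<Rightarrow> 'od set \<times> 'od set" where
  "glued D R PX PY =
     ({W \<in> Obj D. FObj (j_star_up R) W \<in> fst PX \<and> FObj (i_star_up R) W \<in> fst PY},
      {W \<in> Obj D. FObj (j_star_up R) W \<in> snd PX \<and> FObj (i_shriek_up R) W \<in> snd PY})"

end

theory Submission
  imports Defs
begin

text \<open>Three ideas carry the proof. For a silting object \<open>M\<close> put \<open>U = \<D>\<^sub>\<ge>\<^sub>0\<close> and \<open>V = \<D>\<^sub>\<le>\<^sub>0[1]\<close>.
  Orthogonality makes \<open>U * V\<close> closed under extensions, and the objects \<open>W\<close> all of whose shifts lie in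
  \<open>U * V\<close> and whose large shifts lie in \<open>V\<close> form a thick subcategory containing \<open>M\<close>: for \<open>W = A \<oplus> B\<close> the
  rotated split triangle \<open>W \<rightarrow> A \<rightarrow> B[1]\<close> allows a descending induction on the shift, so no
  Krull-Schmidt hypothesis is needed. Hence \<open>M\<close> defines a co-t-structure.

  The object \<open>Z\<close> lies in both glued classes; for \<open>i\<^sup>!K\<close> one composes the unit of \<open>(i\<^sub>*, i\<^sup>!)\<close> with the image
  under \<open>i\<^sup>!\<close> of the defining triangle and finds that \<open>i\<^sup>!K\<close> is the truncation \<open>\<beta>\<^sub>\<le>\<^sub>0 i\<^sup>!j\<^sub>!X\<close>. The glued classes are
  orthogonal by adjunction and \<open>Z\<close> generates \<open>\<D>\<close>, so \<open>Z\<close> is silting.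

  Finally, a pair of classes that contains a co-t-structure and is still orthogonal is equal to it. Applied
  to \<open>Z\<close> this identifies the glued pair, whose truncations therefore need not be glued by hand.\<close>

section \<open>Additive categories\<close>

lemma hom_setD:
  assumes "f \<in> hom_set C A B"
  shows "f \<in> Arr C" "Dom C f = A" "Cod C f = B"
  using assms by (auto simp: hom_set_def)

lemma hom_group_simps [simp]:
  "carrier (hom_group C A B) = hom_set C A B"
  "mult (hom_group C A B) = Add C"
  "one (hom_group C A B) = Zero C A B"
  by (simp_all add: hom_group_def)

lemma (in category) hom_Obj:
  assumes "f \<in> hom_set C A B"
  shows "A \<in> Obj C" "B \<in> Obj C"
  using assms Dom_Obj Cod_Obj by (auto simp: hom_set_def)

lemma (in category) is_isoI:
  assumes "f \<in> hom_set C A B" "g \<in> hom_set C B A" "g \<cdot> f = Id C A" "f \<cdot> g = Id C B"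
  shows "is_iso C f"
  using assms by (auto simp: is_iso_def hom_set_def)

lemma (in category) is_isoE:
  assumes "is_iso C f" "f \<in> hom_set C A B"
  obtains g where "g \<in> hom_set C B A" "g \<cdot> f = Id C A" "f \<cdot> g = Id C B"
  using assms by (auto simp: is_iso_def hom_setD)

lemma (in category) is_iso_Id: "A \<in> Obj C \<Longrightarrow> is_iso C (Id C A)"
  using Id_hom Comp_Id_left by (blast intro: is_isoI)

context additive_category
begin

lemma Zero_hom: "A \<in> Obj C \<Longrightarrow> B \<in> Obj C \<Longrightarrow> Zero C A B \<in> hom_set C A B"
  using group.is_monoid[OF comm_group.axioms(2)[OF hom_comm_group]] monoid.one_closed by fastforce

lemma Add_hom: "f \<in> hom_set C A B \<Longrightarrow> g \<in> hom_set C A B \<Longrightarrow> Add C f g \<in> hom_set C A B"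
  using group.is_monoid[OF comm_group.axioms(2)[OF hom_comm_group[OF hom_Obj]]]
    monoid.m_closed by fastforce

lemma Add_commute:
  assumes "f \<in> hom_set C A B" "g \<in> hom_set C A B"
  shows "Add C f g = Add C g f"
proof -
  interpret comm_group "hom_group C A B" using hom_comm_group hom_Obj[OF assms(1)] by blast
  show ?thesis using m_comm assms by simp
qed

lemma Add_Zero:
  assumes "f \<in> hom_set C A B"
  shows "Add C f (Zero C A B) = f" "Add C (Zero C A B) f = f"
proof -
  interpret comm_group "hom_group C A B" using hom_comm_group hom_Obj[OF assms(1)] by blast
  show "Add C f (Zero C A B) = f" "Add C (Zero C A B) f = f"
    using l_one r_one assms by simp_all
qed

lemma Neg_hom_Add:
  assumes "f \<in> hom_set C A B"
  shows "Neg C f \<in> hom_set C A B" "Add C (Neg C f) f = Zero C A B" "Add C f (Neg C f) = Zero C A B"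
proof -
  interpret comm_group "hom_group C A B" using hom_comm_group hom_Obj[OF assms(1)] by blast
  have "Neg C f = inv\<^bsub>hom_group C A B\<^esub> f" using assms by (simp add: Neg_def hom_setD)
  then show "Neg C f \<in> hom_set C A B" "Add C (Neg C f) f = Zero C A B"
    "Add C f (Neg C f) = Zero C A B"
    using inv_closed l_inv r_inv assms by simp_all
qed

lemmas Neg_hom = Neg_hom_Add(1)

lemma Add_cancel_right:
  assumes "f \<in> hom_set C A B" "g \<in> hom_set C A B" "h \<in> hom_set C A B" "Add C f h = Add C g h"
  shows "f = g"
proof -
  interpret comm_group "hom_group C A B" using hom_comm_group hom_Obj[OF assms(1)] by blast
  show ?thesis using right_cancel assms by simp
qed

text \<open>Cancelling one copy of \<open>f\<close>. Composition and additive functors are only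
  assumed to respect \<open>Add\<close>; this is what makes them respect zero morphisms as
  well.\<close>

lemma Add_idem_Zero:
  assumes "f \<in> hom_set C A B" "Add C f f = f"
  shows "f = Zero C A B"
  using Add_cancel_right[of f A B "Zero C A B" f] assms Zero_hom hom_Obj[OF assms(1)]
  by (simp add: Add_Zero)

lemma Neg_unique:
  assumes "f \<in> hom_set C A B" "g \<in> hom_set C A B" "Add C g f = Zero C A B"
  shows "g = Neg C f"
  using assms Neg_hom_Add Add_cancel_right by metis

lemma Neg_Neg: "f \<in> hom_set C A B \<Longrightarrow> Neg C (Neg C f) = f"
  using Neg_hom_Add Neg_unique by metis

lemma Neg_Zero: "A \<in> Obj C \<Longrightarrow> B \<in> Obj C \<Longrightarrow> Neg C (Zero C A B) = Zero C A B"
  using Neg_unique[OF Zero_hom Zero_hom] Zero_hom Add_Zero by metis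

lemma Comp_Zero_left:
  assumes "f \<in> hom_set C A B" "E \<in> Obj C"
  shows "Zero C B E \<cdot> f = Zero C A E"
proof -
  have z: "Zero C B E \<in> hom_set C B E" using Zero_hom hom_Obj assms by blast
  show ?thesis
    using Comp_Add_left[OF assms(1) z z] Add_Zero(1)[OF z] Add_idem_Zero Comp_hom[OF assms(1) z]
    by simp
qed

lemma Comp_Zero_right:
  assumes "f \<in> hom_set C A B" "E \<in> Obj C"
  shows "f \<cdot> Zero C E A = Zero C E B"
proof -
  have z: "Zero C E A \<in> hom_set C E A" using Zero_hom hom_Obj assms by blast
  show ?thesis
    using Comp_Add_right[OF z z assms(1)] Add_Zero(1)[OF z] Add_idem_Zero Comp_hom[OF z assms(1)]
    by simp
qed

lemma Comp_Neg_right: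
  assumes "f \<in> hom_set C A B" "g \<in> hom_set C B E"
  shows "g \<cdot> Neg C f = Neg C (g \<cdot> f)"
  using Neg_unique[OF Comp_hom[OF assms] Comp_hom[OF Neg_hom[OF assms(1)] assms(2)]]
    Comp_Add_right[OF Neg_hom[OF assms(1)] assms] Neg_hom_Add(2)[OF assms(1)]
    Comp_Zero_right[OF assms(2)] hom_Obj[OF assms(1)] by simp

lemma Comp_Neg_left:
  assumes "f \<in> hom_set C A B" "g \<in> hom_set C B E"
  shows "Neg C g \<cdot> f = Neg C (g \<cdot> f)"
  using Neg_unique[OF Comp_hom[OF assms] Comp_hom[OF assms(1) Neg_hom[OF assms(2)]]]
    Comp_Add_left[OF assms(1) Neg_hom[OF assms(2)] assms(2)] Neg_hom_Add(2)[OF assms(2)]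
    Comp_Zero_left[OF assms(1)] hom_Obj[OF assms(2)] by simp

lemma zero_object_hom:
  assumes "zero_object C N" "A \<in> Obj C"
  shows "f \<in> hom_set C A N \<Longrightarrow> f = Zero C A N" "f \<in> hom_set C N A \<Longrightarrow> f = Zero C N A"
  using assms Zero_hom unfolding zero_object_def by blast+

text \<open>Every morphism into or out of \<open>N\<close> factors through \<open>Id C N\<close>.
  The criterion is later applied to objects orthogonal to themselves, whose identity must
  vanish.\<close>

lemma zero_objectI:
  assumes "N \<in> Obj C" "Id C N = Zero C N N"
  shows "zero_object C N"
proof -
  have "f = Zero C N B" if "f \<in> hom_set C N B" for f B
    using Comp_Id_right[OF that] assms Comp_Zero_right[OF that] by metis
  moreover have "f = Zero C B N" if "f \<in> hom_set C B N" for f B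
    using Comp_Id_left[OF that] assms Comp_Zero_left[OF that] by metis
  ultimately show ?thesis
    unfolding zero_object_def using assms(1) Zero_hom by blast
qed

lemma zero_object_Id: "zero_object C N \<Longrightarrow> Id C N = Zero C N N"
  using zero_object_hom Id_hom by (auto simp: zero_object_def)

lemma is_direct_sum_commute:
  assumes "is_direct_sum C A B S"
  shows "is_direct_sum C B A S"
proof -
  obtain i1 i2 p1 p2 where b: "is_biproduct C A B S i1 i2 p1 p2"
    using assms by (auto simp: is_direct_sum_def)
  then have "Add C (i2 \<cdot> p2) (i1 \<cdot> p1) = Add C (i1 \<cdot> p1) (i2 \<cdot> p2)"
    using Add_commute Comp_hom unfolding is_biproduct_def by blast
  with b have "is_biproduct C B A S i2 i1 p2 p1" by (simp add: is_biproduct_def)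
  then show ?thesis by (auto simp: is_direct_sum_def)
qed

lemma is_direct_sum_Obj:
  assumes "is_direct_sum C A B S"
  shows "A \<in> Obj C" "B \<in> Obj C" "S \<in> Obj C"
  using assms by (auto simp: is_direct_sum_def is_biproduct_def)

text \<open>Asking for an equation of sets, and not just that all morphisms vanish, makes the
  relation imply that both arguments are objects, since \<open>Zero C A B\<close> is then a morphism
  between them; see \<open>orth_Obj\<close>.\<close>

definition orth :: "'o \<Rightarrow> 'o \<Rightarrow> bool" where
  "orth A B \<longleftrightarrow> hom_set C A B = {Zero C A B}"

lemma orthI:
  assumes "A \<in> Obj C" "B \<in> Obj C" "\<And>f. f \<in> hom_set C A B \<Longrightarrow> f = Zero C A B"
  shows "orth A B"
  using assms Zero_hom by (auto simp: orth_def)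

lemma orthD: "orth A B \<Longrightarrow> f \<in> hom_set C A B \<Longrightarrow> f = Zero C A B"
  by (auto simp: orth_def)

lemma orth_Obj:
  assumes "orth A B" shows "A \<in> Obj C" "B \<in> Obj C"
proof -
  have "Zero C A B \<in> hom_set C A B" using assms by (simp add: orth_def)
  then show "A \<in> Obj C" "B \<in> Obj C" using hom_Obj by blast+
qed

text \<open>Extend \<open>f\<close> along the projection to \<open>f \<cdot> p1\<close> on
  \<open>W\<close>, where it vanishes, and recover \<open>f\<close> by restricting along
  \<open>i1\<close>.\<close>

lemma orth_summand_left:
  assumes "is_direct_sum C A A' W" "orth W B"
  shows "orth A B"
proof -
  obtain i1 i2 p1 p2 where b: "is_biproduct C A A' W i1 i2 p1 p2"
    using assms by (auto simp: is_direct_sum_def)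
  show ?thesis
  proof (rule orthI)
    fix f assume f: "f \<in> hom_set C A B"
    have h: "i1 \<in> hom_set C A W" "p1 \<in> hom_set C W A" "p1 \<cdot> i1 = Id C A"
      using b by (auto simp: is_biproduct_def)
    have "f \<cdot> p1 = Zero C W B" using orthD[OF assms(2) Comp_hom[OF h(2) f]] .
    then show "f = Zero C A B"
      using Comp_assoc[OF h(1,2) f] h(3) Comp_Id_right[OF f] Comp_Zero_left[OF h(1)] hom_Obj[OF f]
      by simp
  qed (use assms is_direct_sum_Obj orth_Obj in blast)+
qed

lemma orth_summand_right:
  assumes "is_direct_sum C B B' W" "orth A W"
  shows "orth A B"
proof -
  obtain i1 i2 p1 p2 where b: "is_biproduct C B B' W i1 i2 p1 p2"
    using assms by (auto simp: is_direct_sum_def)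
  show ?thesis
  proof (rule orthI)
    fix f assume f: "f \<in> hom_set C A B"
    have h: "i1 \<in> hom_set C B W" "p1 \<in> hom_set C W B" "p1 \<cdot> i1 = Id C B"
      using b by (auto simp: is_biproduct_def)
    have "i1 \<cdot> f = Zero C A W" using orthD[OF assms(2) Comp_hom[OF f h(1)]] .
    then show "f = Zero C A B"
      using Comp_assoc[OF f h(1,2)] h(3) Comp_Id_left[OF f] Comp_Zero_right[OF h(2)] hom_Obj[OF f]
      by simp
  qed (use assms is_direct_sum_Obj orth_Obj in blast)+
qed

lemma orth_zero_object:
  assumes "zero_object C N" "A \<in> Obj C"
  shows "orth A N" "orth N A"
  using assms zero_object_hom by (auto intro!: orthI simp: zero_object_def)

end

section \<open>Additive functors and adjunctions\<close>

locale additive_functor_between =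
  C: additive_category C + D: additive_category D + additive_functor C D F
  for C :: "('o1, 'm1, 'z1) additive_category_scheme"
    and D :: "('o2, 'm2, 'z2) additive_category_scheme"
    and F :: "('o1, 'm1, 'o2, 'm2, 'z3) functor_data_scheme"
begin

lemma FMor_Zero:
  assumes "A \<in> Obj C" "B \<in> Obj C"
  shows "FMor F (Zero C A B) = Zero D (FObj F A) (FObj F B)"
proof (rule D.Add_idem_Zero)
  have z: "Zero C A B \<in> hom_set C A B" using C.Zero_hom assms .
  show "FMor F (Zero C A B) \<in> hom_set D (FObj F A) (FObj F B)" using FMor_hom[OF z] .
  show "Add D (FMor F (Zero C A B)) (FMor F (Zero C A B)) = FMor F (Zero C A B)"
    using FMor_Add[OF z z] C.Add_Zero[OF z] by simp
qed

lemma FObj_zero_object: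
  assumes "zero_object C N"
  shows "zero_object D (FObj F N)"
proof (rule D.zero_objectI)
  have "N \<in> Obj C" using assms by (simp add: zero_object_def)
  then show "FObj F N \<in> Obj D" "Id D (FObj F N) = Zero D (FObj F N) (FObj F N)"
    using C.zero_object_Id[OF assms] FMor_Id[of N] FMor_Zero[of N N] FObj_Obj[of N] by simp_all
qed

lemma FObj_direct_sum:
  assumes "is_direct_sum C A B S"
  shows "is_direct_sum D (FObj F A) (FObj F B) (FObj F S)"
proof -
  obtain i1 i2 p1 p2 where "is_biproduct C A B S i1 i2 p1 p2"
    using assms by (auto simp: is_direct_sum_def)
  then have o: "A \<in> Obj C" "B \<in> Obj C" "S \<in> Obj C"
    and h: "i1 \<in> hom_set C A S" "i2 \<in> hom_set C B S" "p1 \<in> hom_set C S A" "p2 \<in> hom_set C S B"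
    and e: "p1 \<cdot>\<^bsub>C\<^esub> i1 = Id C A" "p2 \<cdot>\<^bsub>C\<^esub> i2 = Id C B" "p2 \<cdot>\<^bsub>C\<^esub> i1 = Zero C A B"
      "p1 \<cdot>\<^bsub>C\<^esub> i2 = Zero C B A" "Add C (i1 \<cdot>\<^bsub>C\<^esub> p1) (i2 \<cdot>\<^bsub>C\<^esub> p2) = Id C S"
    by (auto simp: is_biproduct_def)
  have "Add D (FMor F i1 \<cdot>\<^bsub>D\<^esub> FMor F p1) (FMor F i2 \<cdot>\<^bsub>D\<^esub> FMor F p2) = Id D (FObj F S)"
    using FMor_Add[OF C.Comp_hom[OF h(3,1)] C.Comp_hom[OF h(4,2)]] e(5)
      FMor_Comp[OF h(3,1)] FMor_Comp[OF h(4,2)] FMor_Id[OF o(3)] by simp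
  then have "is_biproduct D (FObj F A) (FObj F B) (FObj F S)
      (FMor F i1) (FMor F i2) (FMor F p1) (FMor F p2)"
    using o h e(1-4) FMor_Comp[OF h(1,3)] FMor_Comp[OF h(1,4)] FMor_Comp[OF h(2,3)]
      FMor_Comp[OF h(2,4)] FMor_Id FMor_Zero FMor_hom FObj_Obj
    unfolding is_biproduct_def by simp
  then show ?thesis by (auto simp: is_direct_sum_def)
qed

end

text \<open>Only vanishing is transported, so no bijection of hom sets is built. The transpose of a
  morphism vanishes by orthogonality, and a zigzag identity with naturality writes the morphism as
  the transpose of its transpose, which is zero because the functors are additive.\<close>

lemma adjoint_pair_orth_iff:
  assumes adj: "adjoint_pair C D L R \<eta> \<epsilon>"
    and C: "additive_category C" and D: "additive_category D"
    and L: "additive_functor C D L" and R: "additive_functor D C R"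
    and A: "A \<in> Obj C" and B: "B \<in> Obj D"
  shows "additive_category.orth D (FObj L A) B \<longleftrightarrow> additive_category.orth C A (FObj R B)"
proof -
  interpret adjoint_pair C D L R \<eta> \<epsilon> by (rule adj)
  interpret L: additive_functor_between C D L
    using C D L by (simp add: additive_functor_between_def)
  interpret R: additive_functor_between D C R
    using C D R by (simp add: additive_functor_between_def)
  show ?thesis
  proof
    assume o: "L.D.orth (FObj L A) B"
    show "L.C.orth A (FObj R B)"
    proof (rule L.C.orthI[OF A])
      show "FObj R B \<in> Obj C" using B R.FObj_Obj by blast
      fix f assume f: "f \<in> hom_set C A (FObj R B)"
      have lf: "FMor L f \<in> hom_set D (FObj L A) (FObj L (FObj R B))" using L.FMor_hom[OF f] .
      have h: "\<epsilon> B \<cdot>\<^bsub>D\<^esub> FMor L f \<in> hom_set D (FObj L A) B"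
        using L.D.Comp_hom[OF lf counit_hom[OF B]] .
      have RB: "FObj R B \<in> Obj C" by fact
      have "f = Id C (FObj R B) \<cdot>\<^bsub>C\<^esub> f" using L.C.Comp_Id_left[OF f] by simp
      also have "\<dots> = FMor R (\<epsilon> B) \<cdot>\<^bsub>C\<^esub> (\<eta> (FObj R B) \<cdot>\<^bsub>C\<^esub> f)"
        using zigzag_right[OF B] L.C.Comp_assoc[OF f unit_hom[OF RB] R.FMor_hom[OF counit_hom[OF B]]]
        by simp
      also have "\<dots> = FMor R (\<epsilon> B) \<cdot>\<^bsub>C\<^esub> (FMor R (FMor L f) \<cdot>\<^bsub>C\<^esub> \<eta> A)" using unit_natural[OF f] by simp
      also have "\<dots> = FMor R (\<epsilon> B \<cdot>\<^bsub>D\<^esub> FMor L f) \<cdot>\<^bsub>C\<^esub> \<eta> A"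
        using L.C.Comp_assoc[OF unit_hom[OF A] R.FMor_hom[OF lf] R.FMor_hom[OF counit_hom[OF B]]]
          R.FMor_Comp[OF lf counit_hom[OF B]] by simp
      also have "\<dots> = Zero C A (FObj R B)"
        using L.D.orthD[OF o h] R.FMor_Zero[OF L.FObj_Obj[OF A] B]
          L.C.Comp_Zero_left[OF unit_hom[OF A] RB] by simp
      finally show "f = Zero C A (FObj R B)" .
    qed
  next
    assume o: "L.C.orth A (FObj R B)"
    show "L.D.orth (FObj L A) B"
    proof (rule L.D.orthI[OF _ B])
      show LA: "FObj L A \<in> Obj D" using A L.FObj_Obj by blast
      fix f assume f: "f \<in> hom_set D (FObj L A) B"
      have rf: "FMor R f \<in> hom_set C (FObj R (FObj L A)) (FObj R B)" using R.FMor_hom[OF f] .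
      have h: "FMor R f \<cdot>\<^bsub>C\<^esub> \<eta> A \<in> hom_set C A (FObj R B)"
        using L.C.Comp_hom[OF unit_hom[OF A] rf] .
      have "f = f \<cdot>\<^bsub>D\<^esub> Id D (FObj L A)" using L.D.Comp_Id_right[OF f] by simp
      also have "\<dots> = (f \<cdot>\<^bsub>D\<^esub> \<epsilon> (FObj L A)) \<cdot>\<^bsub>D\<^esub> FMor L (\<eta> A)"
        using zigzag_left[OF A] L.D.Comp_assoc[OF L.FMor_hom[OF unit_hom[OF A]] counit_hom[OF LA] f]
        by simp
      also have "\<dots> = (\<epsilon> B \<cdot>\<^bsub>D\<^esub> FMor L (FMor R f)) \<cdot>\<^bsub>D\<^esub> FMor L (\<eta> A)"
        using counit_natural[OF f] by simp
      also have "\<dots> = \<epsilon> B \<cdot>\<^bsub>D\<^esub> FMor L (FMor R f \<cdot>\<^bsub>C\<^esub> \<eta> A)"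
        using L.D.Comp_assoc[OF L.FMor_hom[OF unit_hom[OF A]] L.FMor_hom[OF rf] counit_hom[OF B]]
          L.FMor_Comp[OF unit_hom[OF A] rf] by simp
      also have "\<dots> = Zero D (FObj L A) B"
        using L.C.orthD[OF o h] L.FMor_Zero[OF A R.FObj_Obj[OF B]]
          L.D.Comp_Zero_right[OF counit_hom[OF B] LA] by simp
      finally show "f = Zero D (FObj L A) B" .
    qed
  qed
qed

text \<open>Fullness of \<open>L\<close> lifts the counit at \<open>L A\<close> to some
  \<open>g : R L A -> A\<close>. Faithfulness and one zigzag identity make \<open>g\<close> a left
  inverse of the unit; naturality of the unit at \<open>g\<close> and the other zigzag identity make
  it a right inverse.\<close>

lemma (in adjoint_pair) unit_iso:
  assumes "category C" "category D" "fully_faithful C D L" and A: "A \<in> Obj C"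
  shows "is_iso C (\<eta> A)"
proof -
  interpret C: category C by fact
  interpret D: category D by fact
  interpret L: is_functor C D L by (rule left_functor)
  interpret R: is_functor D C R by (rule right_functor)
  let ?LA = "FObj L A" and ?RLA = "FObj R (FObj L A)"
  have LA: "?LA \<in> Obj D" using L.FObj_Obj A .
  have RLA: "?RLA \<in> Obj C" using R.FObj_Obj LA .
  have e: "\<epsilon> ?LA \<in> hom_set D (FObj L ?RLA) ?LA" using counit_hom LA .
  have bij: "bij_betw (FMor L) (hom_set C P Q) (hom_set D (FObj L P) (FObj L Q))"
    if "P \<in> Obj C" "Q \<in> Obj C" for P Q using assms(3) that by (auto simp: fully_faithful_def)
  obtain g where g: "g \<in> hom_set C ?RLA A" "FMor L g = \<epsilon> ?LA"
    using bij[OF RLA A] e by (metis bij_betw_imp_surj_on imageE)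
  have u: "\<eta> A \<in> hom_set C A ?RLA" using unit_hom A .
  have "FMor L (g \<cdot>\<^bsub>C\<^esub> \<eta> A) = FMor L (Id C A)"
    using L.FMor_Comp[OF u g(1)] g(2) zigzag_left[OF A] L.FMor_Id[OF A] by simp
  then have 1: "g \<cdot>\<^bsub>C\<^esub> \<eta> A = Id C A"
    using bij_betw_imp_inj_on[OF bij[OF A A]] C.Comp_hom[OF u g(1)] C.Id_hom[OF A]
    by (auto dest: inj_onD)
  have 2: "\<eta> A \<cdot>\<^bsub>C\<^esub> g = Id C ?RLA"
    using unit_natural[OF g(1)] g(2) zigzag_right[OF LA] by simp
  show ?thesis using C.is_isoI[OF u g(1) 1 2] .
qed

text \<open>Dual to \<open>unit_iso\<close>: the inverse is the preimage under \<open>R\<close> of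
  the unit at \<open>R B\<close>.\<close>

lemma (in adjoint_pair) counit_iso:
  assumes "category C" "category D" "fully_faithful D C R" and B: "B \<in> Obj D"
  shows "is_iso D (\<epsilon> B)"
proof -
  interpret C: category C by fact
  interpret D: category D by fact
  interpret L: is_functor C D L by (rule left_functor)
  interpret R: is_functor D C R by (rule right_functor)
  let ?RB = "FObj R B" and ?LRB = "FObj L (FObj R B)"
  have RB: "?RB \<in> Obj C" using R.FObj_Obj B .
  have LRB: "?LRB \<in> Obj D" using L.FObj_Obj RB .
  have e: "\<eta> ?RB \<in> hom_set C ?RB (FObj R ?LRB)" using unit_hom RB .
  have bij: "bij_betw (FMor R) (hom_set D P Q) (hom_set C (FObj R P) (FObj R Q))"
    if "P \<in> Obj D" "Q \<in> Obj D" for P Q using assms(3) that by (auto simp: fully_faithful_def)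
  obtain g where g: "g \<in> hom_set D B ?LRB" "FMor R g = \<eta> ?RB"
    using bij[OF B LRB] e by (metis bij_betw_imp_surj_on imageE)
  have u: "\<epsilon> B \<in> hom_set D ?LRB B" using counit_hom B .
  have "FMor R (\<epsilon> B \<cdot>\<^bsub>D\<^esub> g) = FMor R (Id D B)"
    using R.FMor_Comp[OF g(1) u] g(2) zigzag_right[OF B] R.FMor_Id[OF B] by simp
  then have 1: "\<epsilon> B \<cdot>\<^bsub>D\<^esub> g = Id D B"
    using bij_betw_imp_inj_on[OF bij[OF B B]] D.Comp_hom[OF g(1) u] D.Id_hom[OF B]
    by (auto dest: inj_onD)
  have 2: "g \<cdot>\<^bsub>D\<^esub> \<epsilon> B = Id D ?LRB"
    using counit_natural[OF g(1)] g(2) zigzag_left[OF RB] by simp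
  show ?thesis using D.is_isoI[OF u g(1) 2 1] .
qed

section \<open>Distinguished triangles\<close>

text \<open>Closure arguments depend only on the three objects of a triangle, so the morphisms are
  hidden. They reappear only where a composite or a connecting morphism has to be computed.\<close>

definition dist_tri :: "('o, 'm, 'z) triangulated_category_scheme \<Rightarrow> 'o \<Rightarrow> 'o \<Rightarrow> 'o \<Rightarrow> bool" where
  "dist_tri T A B E \<longleftrightarrow> (\<exists>f g h. (f, g, h) \<in> Tri T \<and> Dom T f = A \<and> Cod T f = B \<and> Cod T g = E)"

text \<open>These are exactly the conditions on the sets intersected in
  \<open>additive_extension_hull\<close>. Closure under isomorphism is a consequence, see
  \<open>additively_closed_iso\<close>.\<close>

definition additively_closed :: "('o, 'm, 'z) triangulated_category_scheme \<Rightarrow> 'o set \<Rightarrow> bool" where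
  "additively_closed T S \<longleftrightarrow> S \<subseteq> Obj T \<and>
     closed_under_summands T S \<and> closed_under_sums T S \<and> closed_under_extensions T S"

lemma closed_under_extensions_iff:
  "closed_under_extensions T S \<longleftrightarrow> (\<forall>A B E. dist_tri T A B E \<and> A \<in> S \<and> E \<in> S \<longrightarrow> B \<in> S)"
  unfolding closed_under_extensions_def dist_tri_def by blast

lemma additive_extension_hull_alt:
  "additive_extension_hull T G = \<Inter>{S. G \<subseteq> S \<and> additively_closed T S}"
  by (simp add: additive_extension_hull_def additively_closed_def)

lemma additively_closed_summand:
  "additively_closed T S \<Longrightarrow> is_direct_sum T A B W \<Longrightarrow> W \<in> S \<Longrightarrow> A \<in> S"
  unfolding additively_closed_def closed_under_summands_def by blast

lemma additively_closed_sum: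
  "additively_closed T S \<Longrightarrow> is_direct_sum T A B W \<Longrightarrow> A \<in> S \<Longrightarrow> B \<in> S \<Longrightarrow> W \<in> S"
  unfolding additively_closed_def closed_under_sums_def by blast

lemma additively_closed_zero: "additively_closed T S \<Longrightarrow> zero_object T N \<Longrightarrow> N \<in> S"
  unfolding additively_closed_def closed_under_sums_def by blast

lemma additively_closed_extension:
  "additively_closed T S \<Longrightarrow> dist_tri T A B E \<Longrightarrow> A \<in> S \<Longrightarrow> E \<in> S \<Longrightarrow> B \<in> S"
  unfolding additively_closed_def closed_under_extensions_iff by blast

lemma additively_closed_Obj: "additively_closed T S \<Longrightarrow> A \<in> S \<Longrightarrow> A \<in> Obj T"
  by (auto simp: additively_closed_def)

lemma hull_incl: "G \<subseteq> additive_extension_hull T G"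
  by (auto simp: additive_extension_hull_alt)

lemma hull_least: "additively_closed T S \<Longrightarrow> G \<subseteq> S \<Longrightarrow> additive_extension_hull T G \<subseteq> S"
  by (auto simp: additive_extension_hull_alt)

section \<open>The shift functor, rotation, and half-exactness of Hom\<close>

context triangulated_category
begin

sublocale shift: additive_functor_between T T "shift_functor T"
  using shift_additive additive_category_axioms by (simp add: additive_functor_between_def)

lemma Shift_Obj: "A \<in> Obj T \<Longrightarrow> Shift T A \<in> Obj T"
  using shift.FObj_Obj by (simp add: shift_functor_def)

lemma ShiftMor_hom: "f \<in> hom_set T A B \<Longrightarrow> ShiftMor T f \<in> hom_set T (Shift T A) (Shift T B)"
  using shift.FMor_hom by (simp add: shift_functor_def)

lemma ShiftMor_Id: "A \<in> Obj T \<Longrightarrow> ShiftMor T (Id T A) = Id T (Shift T A)"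
  using shift.FMor_Id by (simp add: shift_functor_def)

lemma ShiftMor_Comp:
  "f \<in> hom_set T A B \<Longrightarrow> g \<in> hom_set T B E \<Longrightarrow> ShiftMor T (g \<cdot> f) = ShiftMor T g \<cdot> ShiftMor T f"
  using shift.FMor_Comp by (simp add: shift_functor_def)

lemma ShiftMor_Add:
  "f \<in> hom_set T A B \<Longrightarrow> g \<in> hom_set T A B
    \<Longrightarrow> ShiftMor T (Add T f g) = Add T (ShiftMor T f) (ShiftMor T g)"
  using shift.FMor_Add by (simp add: shift_functor_def)

lemma ShiftMor_Zero:
  "A \<in> Obj T \<Longrightarrow> B \<in> Obj T \<Longrightarrow> ShiftMor T (Zero T A B) = Zero T (Shift T A) (Shift T B)"
  using shift.FMor_Zero by (simp add: shift_functor_def)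

lemma Shift_zero_object: "zero_object T N \<Longrightarrow> zero_object T (Shift T N)"
  using shift.FObj_zero_object by (simp add: shift_functor_def)

lemma Shift_direct_sum:
  "is_direct_sum T A B S \<Longrightarrow> is_direct_sum T (Shift T A) (Shift T B) (Shift T S)"
  using shift.FObj_direct_sum by (simp add: shift_functor_def)

lemma Shift_inj: "A \<in> Obj T \<Longrightarrow> B \<in> Obj T \<Longrightarrow> Shift T A = Shift T B \<Longrightarrow> A = B"
  using Shift_bij by (auto simp: bij_betw_def dest: inj_onD)

lemma Shift_surj: "B \<in> Obj T \<Longrightarrow> \<exists>A \<in> Obj T. Shift T A = B"
  using Shift_bij unfolding bij_betw_def by (metis imageE)

lemma ShiftMor_inj: "f \<in> hom_set T A B \<Longrightarrow> g \<in> hom_set T A' B' \<Longrightarrow> ShiftMor T f = ShiftMor T g \<Longrightarrow> f = g"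
  using ShiftMor_bij by (auto simp: bij_betw_def hom_set_def dest: inj_onD)

lemma ShiftMor_full:
  assumes "A \<in> Obj T" "B \<in> Obj T" "g \<in> hom_set T (Shift T A) (Shift T B)"
  obtains f where "f \<in> hom_set T A B" "ShiftMor T f = g"
proof -
  have "g \<in> ShiftMor T ` Arr T" using ShiftMor_bij assms(3) by (auto simp: bij_betw_def hom_set_def)
  then obtain f where f: "f \<in> Arr T" "ShiftMor T f = g" by auto
  have "ShiftMor T f \<in> hom_set T (Shift T (Dom T f)) (Shift T (Cod T f))"
    using ShiftMor_hom f(1) by (auto simp: hom_set_def)
  with assms f have "Shift T (Dom T f) = Shift T A" "Shift T (Cod T f) = Shift T B"
    by (auto simp: hom_set_def)
  then have "f \<in> hom_set T A B"
    using Shift_inj assms f(1) Dom_Obj Cod_Obj by (auto simp: hom_set_def)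
  then show thesis using that f(2) by blast
qed

lemma Tri_hom:
  assumes "(f, g, h) \<in> Tri T" "Dom T f = A" "Cod T f = B" "Cod T g = E"
  shows "f \<in> hom_set T A B" "g \<in> hom_set T B E" "h \<in> hom_set T E (Shift T A)"
  using Tri_candidate[OF assms(1)] assms by (auto simp: candidate_triangle_def hom_set_def)

lemma candidateI:
  "f \<in> hom_set T A B \<Longrightarrow> g \<in> hom_set T B E \<Longrightarrow> h \<in> hom_set T E (Shift T A) \<Longrightarrow> candidate_triangle T f g h"
  by (auto simp: candidate_triangle_def hom_set_def)

lemma dist_triE:
  assumes "dist_tri T A B E"
  obtains f g h where "(f, g, h) \<in> Tri T"
    "f \<in> hom_set T A B" "g \<in> hom_set T B E" "h \<in> hom_set T E (Shift T A)"
proof -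
  obtain f g h where "(f, g, h) \<in> Tri T" "Dom T f = A" "Cod T f = B" "Cod T g = E"
    using assms unfolding dist_tri_def by blast
  then show thesis using that Tri_hom by metis
qed

lemma dist_triI:
  "(f, g, h) \<in> Tri T \<Longrightarrow> f \<in> hom_set T A B \<Longrightarrow> g \<in> hom_set T B E \<Longrightarrow> dist_tri T A B E"
  unfolding dist_tri_def by (auto simp: hom_set_def)

lemma dist_tri_Obj:
  assumes "dist_tri T A B E" shows "A \<in> Obj T" "B \<in> Obj T" "E \<in> Obj T"
proof -
  obtain f g h where "f \<in> hom_set T A B" "g \<in> hom_set T B E" using dist_triE[OF assms] by metis
  then show "A \<in> Obj T" "B \<in> Obj T" "E \<in> Obj T" using hom_Obj by blast+
qed

lemma Tri_rotate_left:
  assumes "(f, g, h) \<in> Tri T"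
  shows "(g, h, Neg T (ShiftMor T f)) \<in> Tri T"
  using Tri_rotate Tri_candidate assms by blast

lemma dist_tri_rotate:
  assumes "dist_tri T A B E" shows "dist_tri T B E (Shift T A)"
proof -
  obtain f g h where t: "(f, g, h) \<in> Tri T"
    and h: "f \<in> hom_set T A B" "g \<in> hom_set T B E" "h \<in> hom_set T E (Shift T A)"
    using dist_triE[OF assms] .
  show ?thesis using dist_triI[OF Tri_rotate_left[OF t] h(2,3)] .
qed

lemma triangle_morphismI:
  assumes "f \<in> hom_set T A B" "g \<in> hom_set T B E" "h \<in> hom_set T E (Shift T A)"
    and "f' \<in> hom_set T A' B'" "g' \<in> hom_set T B' E'" "h' \<in> hom_set T E' (Shift T A')"
    and "a \<in> hom_set T A A'" "b \<in> hom_set T B B'" "c \<in> hom_set T E E'"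
    and "f' \<cdot> a = b \<cdot> f" "g' \<cdot> b = c \<cdot> g" "h' \<cdot> c = ShiftMor T a \<cdot> h"
  shows "triangle_morphism T (f, g, h) (f', g', h') a b c"
  using assms by (simp add: triangle_morphism_def hom_setD)

lemma Tri_morphismE:
  assumes "(f, g, h) \<in> Tri T" "f \<in> hom_set T A B" "g \<in> hom_set T B E" "h \<in> hom_set T E (Shift T A)"
    and "(f', g', h') \<in> Tri T" "f' \<in> hom_set T A' B'" "g' \<in> hom_set T B' E'"
      "h' \<in> hom_set T E' (Shift T A')"
    and "a \<in> hom_set T A A'" "b \<in> hom_set T B B'" "f' \<cdot> a = b \<cdot> f"
  obtains c where "c \<in> hom_set T E E'" "g' \<cdot> b = c \<cdot> g" "h' \<cdot> c = ShiftMor T a \<cdot> h"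
  using Tri_morphism[OF assms(1,5), of a b] assms that
  by (auto simp: triangle_morphism_def hom_setD)

lemma Tri_iso':
  assumes "(f, g, h) \<in> Tri T" "f \<in> hom_set T A B" "g \<in> hom_set T B E" "h \<in> hom_set T E (Shift T A)"
    and "f' \<in> hom_set T A' B'" "g' \<in> hom_set T B' E'" "h' \<in> hom_set T E' (Shift T A')"
    and "a \<in> hom_set T A A'" "b \<in> hom_set T B B'" "c \<in> hom_set T E E'"
    and "f' \<cdot> a = b \<cdot> f" "g' \<cdot> b = c \<cdot> g" "h' \<cdot> c = ShiftMor T a \<cdot> h"
    and "is_iso T a" "is_iso T b" "is_iso T c"
  shows "(f', g', h') \<in> Tri T"
  using Tri_iso[OF assms(1) candidateI[OF assms(5-7)] triangle_morphismI[OF assms(2-13)] assms(14-16)] .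

lemma Tri_zero_Id:
  assumes "A \<in> Obj T" "zero_object T N"
  shows "(Zero T N A, Id T A, Zero T A (Shift T N)) \<in> Tri T"
proof -
  have N: "N \<in> Obj T" using assms by (simp add: zero_object_def)
  have "candidate_triangle T (Zero T N A) (Id T A) (Zero T A (Shift T N))"
    using candidateI[OF Zero_hom Id_hom Zero_hom] N assms Shift_Obj by blast
  moreover have "Neg T (ShiftMor T (Zero T N A)) = Zero T (Shift T N) (Shift T A)"
    using ShiftMor_Zero Neg_Zero Shift_Obj N assms by simp
  ultimately show ?thesis
    using Tri_rotate Tri_Id[OF assms(1) Shift_zero_object[OF assms(2)]] by simp
qed

text \<open>Map the triangle \<open>A -> A -> 0\<close> to the given one by \<open>Id T A\<close>
  and \<open>f\<close>: the third component exhibits \<open>g \<cdot> f\<close> as a morphism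
  factoring through zero.\<close>

lemma Tri_Comp_zero:
  assumes t: "(f, g, h) \<in> Tri T" and h: "f \<in> hom_set T A B" "g \<in> hom_set T B E" "h \<in> hom_set T E (Shift T A)"
  shows "g \<cdot> f = Zero T A E"
proof -
  obtain N where N: "zero_object T N" using ex_zero_object by blast
  have o: "A \<in> Obj T" "E \<in> Obj T" "N \<in> Obj T" using hom_Obj h N by (auto simp: zero_object_def)
  obtain c where c: "c \<in> hom_set T N E" "g \<cdot> f = c \<cdot> Zero T A N"
    using Tri_morphismE[OF Tri_Id[OF o(1) N] Id_hom[OF o(1)] Zero_hom[OF o(1,3)]
        Zero_hom[OF o(3) Shift_Obj[OF o(1)]] t h Id_hom[OF o(1)] h(1) refl] by blast
  then show ?thesis using Comp_Zero_right o by simp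
qed

text \<open>The factorization is the third component of a morphism to the triangle
  \<open>0 -> W -> W\<close> whose first two components are zero and \<open>x\<close>.\<close>

lemma Tri_weak_cokernel:
  assumes t: "(f, g, h) \<in> Tri T" and h: "f \<in> hom_set T A B" "g \<in> hom_set T B E" "h \<in> hom_set T E (Shift T A)"
    and x: "x \<in> hom_set T B W" "x \<cdot> f = Zero T A W"
  obtains y where "y \<in> hom_set T E W" "x = y \<cdot> g"
proof -
  obtain N where N: "zero_object T N" using ex_zero_object by blast
  have o: "A \<in> Obj T" "W \<in> Obj T" "N \<in> Obj T" using hom_Obj h x N by (auto simp: zero_object_def)
  have "Zero T N W \<cdot> Zero T A N = x \<cdot> f" using x Comp_Zero_left Zero_hom o by metis
  then obtain c where c: "c \<in> hom_set T E W" "Id T W \<cdot> x = c \<cdot> g"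
    using Tri_morphismE[OF t h Tri_zero_Id[OF o(2) N] Zero_hom[OF o(3,2)] Id_hom[OF o(2)]
        Zero_hom[OF o(2) Shift_Obj[OF o(3)]] Zero_hom[OF o(1,3)] x(1)] by blast
  then show thesis using that Comp_Id_left[OF x(1)] by metis
qed

text \<open>The morphism axiom only supplies third components. Hence both the given triangle and
  \<open>W -> W -> 0\<close> are rotated, which moves the wanted component to the third place, and
  the result is unshifted. Each rotation brings in one sign, and the two signs cancel.\<close>

lemma Tri_weak_kernel:
  assumes t: "(f, g, h) \<in> Tri T" and h: "f \<in> hom_set T A B" "g \<in> hom_set T B E" "h \<in> hom_set T E (Shift T A)"
    and x: "x \<in> hom_set T W B" "g \<cdot> x = Zero T W E"
  obtains y where "y \<in> hom_set T W A" "x = f \<cdot> y"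
proof -
  obtain N where N: "zero_object T N" using ex_zero_object by blast
  have o: "A \<in> Obj T" "W \<in> Obj T" "N \<in> Obj T" "E \<in> Obj T"
    using hom_Obj h x N by (auto simp: zero_object_def)
  have sh: "Neg T (ShiftMor T f) \<in> hom_set T (Shift T A) (Shift T B)"
    using Neg_hom ShiftMor_hom h by blast
  have si: "Neg T (ShiftMor T (Id T W)) \<in> hom_set T (Shift T W) (Shift T W)"
    using Neg_hom ShiftMor_hom Id_hom o by blast
  have "g \<cdot> x = Zero T N E \<cdot> Zero T W N" using x Comp_Zero_left Zero_hom o by metis
  then obtain c where c: "c \<in> hom_set T (Shift T W) (Shift T A)"
    "Neg T (ShiftMor T f) \<cdot> c = ShiftMor T x \<cdot> Neg T (ShiftMor T (Id T W))"
    using Tri_morphismE[OF Tri_rotate_left[OF Tri_Id[OF o(2) N]] Zero_hom[OF o(2,3)]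
        Zero_hom[OF o(3) Shift_Obj[OF o(2)]] si Tri_rotate_left[OF t] h(2,3) sh x(1) Zero_hom[OF o(3,4)]]
    by metis
  obtain y where y: "y \<in> hom_set T W A" "ShiftMor T y = c" using ShiftMor_full[OF o(2,1) c(1)] .
  have sx: "ShiftMor T x \<in> hom_set T (Shift T W) (Shift T B)" using ShiftMor_hom x(1) .
  have iW: "Id T (Shift T W) \<in> hom_set T (Shift T W) (Shift T W)" using Id_hom Shift_Obj o by blast
  have fy: "ShiftMor T (f \<cdot> y) = ShiftMor T f \<cdot> c" using ShiftMor_Comp[OF y(1) h(1)] y(2) by simp
  have fc: "ShiftMor T f \<cdot> c \<in> hom_set T (Shift T W) (Shift T B)"
    using Comp_hom[OF c(1) ShiftMor_hom[OF h(1)]] .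
  have "Neg T (ShiftMor T f \<cdot> c) = Neg T (ShiftMor T x)"
    using c(2) Comp_Neg_left[OF c(1) ShiftMor_hom[OF h(1)]] Comp_Neg_right[OF iW sx]
      Comp_Id_right[OF sx] ShiftMor_Id[OF o(2)] by simp
  then have "ShiftMor T f \<cdot> c = ShiftMor T x" using Neg_Neg fc sx by metis
  then have "f \<cdot> y = x" using fy ShiftMor_inj[OF Comp_hom[OF y(1) h(1)] x(1)] by simp
  then show thesis using that y by blast
qed

lemma orth_extension_left:
  assumes "dist_tri T A W E" "orth A B" "orth E B"
  shows "orth W B"
proof (rule orthI)
  obtain f g h where t: "(f, g, h) \<in> Tri T"
    and h: "f \<in> hom_set T A W" "g \<in> hom_set T W E" "h \<in> hom_set T E (Shift T A)"
    using dist_triE[OF assms(1)] .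
  show B: "B \<in> Obj T" using orth_Obj assms by blast
  fix x assume x: "x \<in> hom_set T W B"
  obtain y where y: "y \<in> hom_set T E B" "x = y \<cdot> g"
    using Tri_weak_cokernel[OF t h x orthD[OF assms(2) Comp_hom[OF h(1) x]]] .
  then show "x = Zero T W B" using orthD[OF assms(3)] Comp_Zero_left[OF h(2) B] by auto
qed (use assms dist_tri_Obj in blast)

lemma orth_extension_right:
  assumes "dist_tri T A W E" "orth B A" "orth B E"
  shows "orth B W"
proof (rule orthI)
  obtain f g h where t: "(f, g, h) \<in> Tri T"
    and h: "f \<in> hom_set T A W" "g \<in> hom_set T W E" "h \<in> hom_set T E (Shift T A)"
    using dist_triE[OF assms(1)] .
  show B: "B \<in> Obj T" using orth_Obj assms by blast
  fix x assume x: "x \<in> hom_set T B W"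
  obtain y where y: "y \<in> hom_set T B A" "x = f \<cdot> y"
    using Tri_weak_kernel[OF t h x orthD[OF assms(3) Comp_hom[OF x h(2)]]] .
  then show "x = Zero T B W" using orthD[OF assms(2)] Comp_Zero_right[OF h(1) B] by auto
qed (use assms dist_tri_Obj in blast)

text \<open>Rotating three times shifts the triangle and negates each of its morphisms.\<close>

lemma Tri_Shift_iff:
  assumes "f \<in> hom_set T A B" "g \<in> hom_set T B E" "h \<in> hom_set T E (Shift T A)"
  shows "(f, g, h) \<in> Tri T \<longleftrightarrow>
    (Neg T (ShiftMor T f), Neg T (ShiftMor T g), Neg T (ShiftMor T h)) \<in> Tri T"
proof -
  have n: "Neg T (ShiftMor T f) \<in> hom_set T (Shift T A) (Shift T B)"
    "Neg T (ShiftMor T g) \<in> hom_set T (Shift T B) (Shift T E)"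
    using assms Neg_hom ShiftMor_hom by blast+
  show ?thesis
    using Tri_rotate[OF candidateI[OF assms]] Tri_rotate[OF candidateI[OF assms(2,3) n(1)]]
      Tri_rotate[OF candidateI[OF assms(3) n]] by simp
qed

lemma dist_tri_Shift_iff:
  assumes o: "A \<in> Obj T" "B \<in> Obj T" "E \<in> Obj T"
  shows "dist_tri T (Shift T A) (Shift T B) (Shift T E) \<longleftrightarrow> dist_tri T A B E"
proof
  assume "dist_tri T A B E"
  then obtain f g h where t: "(f, g, h) \<in> Tri T"
    and h: "f \<in> hom_set T A B" "g \<in> hom_set T B E" "h \<in> hom_set T E (Shift T A)"
    by (rule dist_triE)
  then show "dist_tri T (Shift T A) (Shift T B) (Shift T E)"
    using Tri_Shift_iff[OF h] dist_triI Neg_hom ShiftMor_hom by blast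
next
  assume "dist_tri T (Shift T A) (Shift T B) (Shift T E)"
  then obtain f g h where t: "(f, g, h) \<in> Tri T"
    and h: "f \<in> hom_set T (Shift T A) (Shift T B)" "g \<in> hom_set T (Shift T B) (Shift T E)"
      "h \<in> hom_set T (Shift T E) (Shift T (Shift T A))"
    by (rule dist_triE)
  \<comment> \<open>Unshifting the negatives absorbs the three signs of
    \<open>Tri_Shift_iff\<close>.\<close>
  obtain a where a: "a \<in> hom_set T A B" "ShiftMor T a = Neg T f"
    using ShiftMor_full[OF o(1,2) Neg_hom[OF h(1)]] .
  obtain b where b: "b \<in> hom_set T B E" "ShiftMor T b = Neg T g"
    using ShiftMor_full[OF o(2,3) Neg_hom[OF h(2)]] .
  obtain c where c: "c \<in> hom_set T E (Shift T A)" "ShiftMor T c = Neg T h"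
    using ShiftMor_full[OF o(3) Shift_Obj[OF o(1)] Neg_hom[OF h(3)]] .
  have "(a, b, c) \<in> Tri T"
    using Tri_Shift_iff[OF a(1) b(1) c(1)] a(2) b(2) c(2) h t by (simp add: Neg_Neg)
  then show "dist_tri T A B E" using dist_triI a b by blast
qed

lemma Tri_iso_zero:
  assumes "f \<in> hom_set T A B" "is_iso T f" "zero_object T N"
  shows "(f, Zero T B N, Zero T N (Shift T A)) \<in> Tri T"
proof -
  have o: "A \<in> Obj T" "B \<in> Obj T" "N \<in> Obj T" using assms hom_Obj by (auto simp: zero_object_def)
  note i = Id_hom[OF o(1)] Id_hom[OF o(2)] Id_hom[OF o(3)]
  have s: "Shift T A \<in> Obj T" using Shift_Obj o by blast
  note z = Zero_hom[OF o(1,3)] Zero_hom[OF o(2,3)] Zero_hom[OF o(3) s]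
  show ?thesis
  proof (rule Tri_iso'[OF Tri_Id[OF o(1) assms(3)] i(1) z(1,3) assms(1) z(2,3) i(1) assms(1) i(3)])
    show "f \<cdot> Id T A = f \<cdot> Id T A" ..
    show "Zero T B N \<cdot> f = Id T N \<cdot> Zero T A N"
      using Comp_Zero_left[OF assms(1) o(3)] Comp_Id_left[OF z(1)] by simp
    show "Zero T N (Shift T A) \<cdot> Id T N = ShiftMor T (Id T A) \<cdot> Zero T N (Shift T A)"
      using Comp_Id_right[OF z(3)] Comp_Id_left[OF z(3)] ShiftMor_Id[OF o(1)] by simp
  qed (use is_iso_Id o assms in auto)
qed

lemma dist_tri_iso:
  assumes "f \<in> hom_set T A B" "is_iso T f" "zero_object T N"
  shows "dist_tri T A B N"
  using dist_triI[OF Tri_iso_zero[OF assms] assms(1) Zero_hom] hom_Obj[OF assms(1)] assms(3)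
  by (simp add: zero_object_def)

lemma dist_tri_iso_third:
  assumes "dist_tri T A B E" "c \<in> hom_set T E E'" "is_iso T c"
  shows "dist_tri T A B E'"
proof -
  obtain f g h where t: "(f, g, h) \<in> Tri T"
    and h: "f \<in> hom_set T A B" "g \<in> hom_set T B E" "h \<in> hom_set T E (Shift T A)"
    using dist_triE[OF assms(1)] .
  obtain d where d: "d \<in> hom_set T E' E" "d \<cdot> c = Id T E" using is_isoE[OF assms(3,2)] by metis
  note o = hom_Obj[OF h(1)]
  note cg = Comp_hom[OF h(2) assms(2)] and hd = Comp_hom[OF d(1) h(3)]
  have "(f, c \<cdot> g, h \<cdot> d) \<in> Tri T"
  proof (rule Tri_iso'[OF t h h(1) cg hd Id_hom[OF o(1)] Id_hom[OF o(2)] assms(2)])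
    show "f \<cdot> Id T A = Id T B \<cdot> f" using Comp_Id_left[OF h(1)] Comp_Id_right[OF h(1)] by simp
    show "c \<cdot> g \<cdot> Id T B = c \<cdot> g" using Comp_Id_right[OF cg] .
    show "h \<cdot> d \<cdot> c = ShiftMor T (Id T A) \<cdot> h"
      using Comp_assoc[OF assms(2) d(1) h(3)] d(2) Comp_Id_right[OF h(3)] Comp_Id_left[OF h(3)]
        ShiftMor_Id[OF o(1)] by simp
  qed (use is_iso_Id o assms in auto)
  then show ?thesis using dist_triI h(1) cg by blast
qed

section \<open>Split triangles and the octahedral axiom\<close>

text \<open>A zero connecting morphism makes \<open>f\<close> split mono and \<open>g\<close> split
  epi, with splittings obtained from the weak cokernel and weak kernel properties of the rotated
  triangles. What remains is to adjust them to a biproduct.\<close>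

lemma Tri_Zero_direct_sum:
  assumes t: "(f, g, h) \<in> Tri T"
    and h: "f \<in> hom_set T A B" "g \<in> hom_set T B E" "h \<in> hom_set T E (Shift T A)"
    and z: "h = Zero T E (Shift T A)"
  shows "is_direct_sum T A E B"
proof -
  have o: "A \<in> Obj T" "B \<in> Obj T" "E \<in> Obj T" "Shift T A \<in> Obj T"
    using hom_Obj h by blast+
  note id = Id_hom[OF o(1)] Id_hom[OF o(2)] Id_hom[OF o(3)] Id_hom[OF o(4)]
  note t1 = Tri_rotate_left[OF t]
  note t2 = Tri_rotate_left[OF t1]
  note sf = ShiftMor_hom[OF h(1)]
  note nsf = Neg_hom[OF sf]
  note nsg = Neg_hom[OF ShiftMor_hom[OF h(2)]]
  have "Id T (Shift T A) \<cdot> h = Zero T E (Shift T A)" using Comp_Id_left[OF h(3)] z by simp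
  then obtain y where y: "y \<in> hom_set T (Shift T B) (Shift T A)"
    "Id T (Shift T A) = y \<cdot> Neg T (ShiftMor T f)"
    using Tri_weak_cokernel[OF t2 h(3) nsf nsg id(4)] by blast
  \<comment> \<open>The rotated triangle contains \<open>- f[1]\<close>, so the sign moves into the
    retraction.\<close>
  obtain r where r: "r \<in> hom_set T B A" "ShiftMor T r = Neg T y"
    using ShiftMor_full[OF o(2,1) Neg_hom[OF y(1)]] .
  have "ShiftMor T (r \<cdot> f) = ShiftMor T (Id T A)"
    using ShiftMor_Comp[OF h(1) r(1)] r(2) y(2) Comp_Neg_left[OF sf y(1)] Comp_Neg_right[OF sf y(1)]
      ShiftMor_Id[OF o(1)] by simp
  then have rf: "r \<cdot> f = Id T A" using ShiftMor_inj[OF Comp_hom[OF h(1) r(1)] id(1)] by simp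
  have gf: "g \<cdot> f = Zero T A E" using Tri_Comp_zero[OF t h] .
  have "h \<cdot> Id T E = Zero T E (Shift T A)" using Comp_Id_right[OF h(3)] z by simp
  then obtain s' where s': "s' \<in> hom_set T E B" "Id T E = g \<cdot> s'"
    using Tri_weak_kernel[OF t1 h(2,3) nsf id(3)] by blast
  have u: "r \<cdot> s' \<in> hom_set T E A" using Comp_hom[OF s'(1) r(1)] .
  have fu: "f \<cdot> (r \<cdot> s') \<in> hom_set T E B" using Comp_hom[OF u h(1)] .
  \<comment> \<open>The section \<open>s'\<close> need not satisfy \<open>r \<cdot> s' = 0\<close>.
    Subtracting its component along \<open>f\<close> enforces this without changing
    \<open>g \<cdot> s'\<close>.\<close>
  define s where "s = Add T s' (Neg T (f \<cdot> (r \<cdot> s')))"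
  have s: "s \<in> hom_set T E B" unfolding s_def using Add_hom[OF s'(1) Neg_hom[OF fu]] .
  have "g \<cdot> (f \<cdot> (r \<cdot> s')) = Zero T E E"
    using Comp_assoc[OF u h(1,2)] gf Comp_Zero_left[OF u o(3)] by simp
  then have gs: "g \<cdot> s = Id T E"
    unfolding s_def using Comp_Add_right[OF s'(1) Neg_hom[OF fu] h(2)] Comp_Neg_right[OF fu h(2)]
      s'(2)[symmetric] Neg_Zero[OF o(3,3)] Add_Zero(1)[OF id(3)] by simp
  have "r \<cdot> (f \<cdot> (r \<cdot> s')) = r \<cdot> s'"
    using Comp_assoc[OF u h(1) r(1)] rf Comp_Id_left[OF u] by simp
  then have rs: "r \<cdot> s = Zero T E A"
    unfolding s_def using Comp_Add_right[OF s'(1) Neg_hom[OF fu] r(1)] Comp_Neg_right[OF fu r(1)]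
      Neg_hom_Add(3)[OF u] by simp
  note fr = Comp_hom[OF r(1) h(1)] and sg = Comp_hom[OF h(2) s]
  define e where "e = Add T (f \<cdot> r) (s \<cdot> g)"
  have e: "e \<in> hom_set T B B" unfolding e_def using Add_hom[OF fr sg] .
  have ge: "g \<cdot> e = g"
    unfolding e_def using Comp_Add_right[OF fr sg h(2)] Comp_assoc[OF r(1) h(1,2)] gf
      Comp_Zero_left[OF r(1) o(3)] Comp_assoc[OF h(2) s h(2)] gs Comp_Id_left[OF h(2)]
      Add_Zero(2)[OF h(2)] by simp
  have re: "r \<cdot> e = r"
    unfolding e_def using Comp_Add_right[OF fr sg r(1)] Comp_assoc[OF r(1) h(1) r(1)] rf
      Comp_Id_left[OF r(1)] Comp_assoc[OF h(2) s r(1)] rs Comp_Zero_left[OF h(2) o(1)]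
      Add_Zero(1)[OF r(1)] by simp
  \<comment> \<open>The defect \<open>d = 1 - e\<close> is killed by \<open>g\<close>, hence factors
    through \<open>f\<close>; it is also killed by the retraction \<open>r\<close> of
    \<open>f\<close>, so the factor vanishes.\<close>
  define d where "d = Add T (Id T B) (Neg T e)"
  have d: "d \<in> hom_set T B B" unfolding d_def using Add_hom[OF id(2) Neg_hom[OF e]] .
  have gd: "g \<cdot> d = Zero T B E"
    unfolding d_def using Comp_Add_right[OF id(2) Neg_hom[OF e] h(2)] Comp_Id_right[OF h(2)]
      Comp_Neg_right[OF e h(2)] ge Neg_hom_Add(3)[OF h(2)] by simp
  have rd: "r \<cdot> d = Zero T B A"
    unfolding d_def using Comp_Add_right[OF id(2) Neg_hom[OF e] r(1)] Comp_Id_right[OF r(1)]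
      Comp_Neg_right[OF e r(1)] re Neg_hom_Add(3)[OF r(1)] by simp
  obtain w where w: "w \<in> hom_set T B A" "d = f \<cdot> w" using Tri_weak_kernel[OF t h d gd] .
  have "w = Zero T B A"
    using rd w(2) Comp_assoc[OF w(1) h(1) r(1)] rf Comp_Id_left[OF w(1)] by simp
  then have "d = Zero T B B" using w(2) Comp_Zero_right[OF h(1) o(2)] by simp
  then have "e = Id T B" unfolding d_def using Neg_unique[OF Neg_hom[OF e] id(2)] Neg_Neg[OF e] by simp
  then have "is_biproduct T A E B f s r g"
    unfolding is_biproduct_def e_def using o h s r(1) rf gs gf rs by simp
  then show ?thesis by (auto simp: is_direct_sum_def)
qed

text \<open>Complete \<open>i1\<close> to a triangle. Since \<open>i1\<close> is split mono the
  connecting morphism vanishes, and the cone can be identified with \<open>B\<close>.\<close>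

lemma dist_tri_direct_sum:
  assumes "is_direct_sum T A B W"
  shows "dist_tri T A W B"
proof -
  obtain i1 i2 p1 p2 where "is_biproduct T A B W i1 i2 p1 p2"
    using assms by (auto simp: is_direct_sum_def)
  then have o: "A \<in> Obj T" "B \<in> Obj T" "W \<in> Obj T"
    and h: "i1 \<in> hom_set T A W" "i2 \<in> hom_set T B W" "p1 \<in> hom_set T W A" "p2 \<in> hom_set T W B"
    and e: "p1 \<cdot> i1 = Id T A" "p2 \<cdot> i2 = Id T B" "p2 \<cdot> i1 = Zero T A B"
      "Add T (i1 \<cdot> p1) (i2 \<cdot> p2) = Id T W"
    by (auto simp: is_biproduct_def)
  obtain q r where t: "(i1, q, r) \<in> Tri T" using Tri_complete[OF hom_setD(1)[OF h(1)]] by blast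
  define E where "E = Cod T q"
  note qr = Tri_hom(2,3)[OF t hom_setD(2,3)[OF h(1)] E_def[symmetric]]
  have oE: "E \<in> Obj T" "Shift T A \<in> Obj T" using hom_Obj qr by blast+
  note t1 = Tri_rotate_left[OF t]
  note si = ShiftMor_hom[OF h(1)]
  note nsi = Neg_hom[OF si]
  \<comment> \<open>Consecutive morphisms compose to zero. Composing with \<open>p1[1]\<close>,
    which is left inverse to \<open>i1[1]\<close>, then gives \<open>r = 0\<close>.\<close>
  have "Neg T (ShiftMor T i1) \<cdot> r = Zero T E (Shift T W)"
    using Tri_Comp_zero[OF Tri_rotate_left[OF t1] qr(2) nsi Neg_hom[OF ShiftMor_hom[OF qr(1)]]] .
  then have "ShiftMor T i1 \<cdot> r = Zero T E (Shift T W)"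
    using Comp_Neg_left[OF qr(2) si] Neg_Neg[OF Comp_hom[OF qr(2) si]] Neg_Zero[OF oE(1) Shift_Obj[OF o(3)]]
    by simp
  then have r0: "r = Zero T E (Shift T A)"
    using Comp_assoc[OF qr(2) si ShiftMor_hom[OF h(3)]] ShiftMor_Comp[OF h(1,3)] e(1) ShiftMor_Id[OF o(1)]
      Comp_Id_left[OF qr(2)] Comp_Zero_right[OF ShiftMor_hom[OF h(3)] oE(1)] by simp
  \<comment> \<open>This \<open>c\<close> compares the cone with \<open>B\<close>; its inverse will
    be \<open>q \<cdot> i2\<close>.\<close>
  obtain c where c: "c \<in> hom_set T E B" "p2 = c \<cdot> q"
    using Tri_weak_cokernel[OF t h(1) qr h(4) e(3)] .
  have "r \<cdot> Id T E = Zero T E (Shift T A)" using Comp_Id_right[OF qr(2)] r0 by simp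
  then obtain m where m: "m \<in> hom_set T E W" "Id T E = q \<cdot> m"
    using Tri_weak_kernel[OF t1 qr nsi Id_hom[OF oE(1)]] by blast
  have qi: "q \<cdot> i2 \<in> hom_set T B E" using Comp_hom[OF h(2) qr(1)] .
  have inv1: "c \<cdot> (q \<cdot> i2) = Id T B" using Comp_assoc[OF h(2) qr(1) c(1)] c(2) e(2) by simp
  note ip1 = Comp_hom[OF h(3,1)] and ip2 = Comp_hom[OF h(4,2)]
  have "q = q \<cdot> Id T W" using Comp_Id_right[OF qr(1)] by simp
  also have "\<dots> = Add T (q \<cdot> (i1 \<cdot> p1)) (q \<cdot> (i2 \<cdot> p2))"
    using Comp_Add_right[OF ip1 ip2 qr(1)] e(4) by simp
  also have "q \<cdot> (i1 \<cdot> p1) = Zero T W E"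
    using Comp_assoc[OF h(3,1) qr(1)] Tri_Comp_zero[OF t h(1) qr] Comp_Zero_left[OF h(3) oE(1)] by simp
  finally have q2: "q \<cdot> (i2 \<cdot> p2) = q" using Add_Zero(2)[OF Comp_hom[OF ip2 qr(1)]] by simp
  \<comment> \<open>With a section \<open>m\<close> of \<open>q\<close>, the composite
    \<open>q i2 c\<close> becomes \<open>q (i2 p2) m\<close>. Since \<open>q\<close> kills
    \<open>i1 p1\<close>, this is \<open>q m\<close>, the identity.\<close>
  have cm: "c = p2 \<cdot> m" using c m(2) Comp_assoc[OF m(1) qr(1) c(1)] Comp_Id_right[OF c(1)] by simp
  have "q \<cdot> i2 \<cdot> c = q \<cdot> (i2 \<cdot> p2) \<cdot> m"
    using cm Comp_assoc[OF m(1) h(4) qi] Comp_assoc[OF h(4,2) qr(1)] by simp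
  then have inv2: "q \<cdot> i2 \<cdot> c = Id T E" using q2 m(2) by simp
  show ?thesis
    using dist_tri_iso_third[OF dist_triI[OF t h(1) qr(1)] c(1) is_isoI[OF c(1) qi inv2 inv1]] .
qed

lemma dist_tri_unrotate:
  assumes "dist_tri T A B (Shift T E)" "E \<in> Obj T"
  shows "dist_tri T E A B"
  using dist_tri_rotate[OF dist_tri_rotate[OF assms(1)]] dist_tri_Shift_iff dist_tri_Obj[OF assms(1)]
    assms(2) by blast

text \<open>Here \<open>H\<close> is the cone of the composite \<open>A -> B -> F\<close>. In terms
  of extensions, this rebrackets \<open>(A * E) * G\<close> as \<open>A * (E * G)\<close> for
  \<open>F\<close>.\<close>

lemma dist_tri_octahedral:
  assumes "dist_tri T A B E" "dist_tri T B F G"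
  obtains H where "dist_tri T A F H" "dist_tri T E H G"
proof -
  obtain f f' f'' where f: "(f, f', f'') \<in> Tri T" "f \<in> hom_set T A B" "f' \<in> hom_set T B E"
    using dist_triE[OF assms(1)] by metis
  obtain g g' g'' where g: "(g, g', g'') \<in> Tri T" "g \<in> hom_set T B F" "g' \<in> hom_set T F G"
    using dist_triE[OF assms(2)] by metis
  have gf: "g \<cdot> f \<in> hom_set T A F" using Comp_hom[OF f(2) g(2)] .
  obtain h' h'' where h: "(g \<cdot> f, h', h'') \<in> Tri T" using Tri_complete[OF hom_setD(1)[OF gf]] by blast
  have h': "h' \<in> hom_set T F (Cod T h')"
    using Tri_hom(2)[OF h hom_setD(2,3)[OF gf] refl] .
  have "Cod T f = Dom T g" using f g by (simp add: hom_set_def)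
  then obtain u v where "(u, v, ShiftMor T f' \<cdot> g'') \<in> Tri T"
    "u \<in> hom_set T (Cod T f') (Cod T h')" "v \<in> hom_set T (Cod T h') (Cod T g')"
    using Tri_octahedral f(1) g(1) h by meson
  then have "dist_tri T E (Cod T h') G" using f g dist_triI by (auto simp: hom_setD)
  then show thesis using that dist_triI[OF h gf h'] by blast
qed

text \<open>The opposite rebracketing: apply the octahedral axiom to \<open>F -> G -> W\<close>. The
  cone of this composite is \<open>E[1]\<close>, and \<open>E\<close> is recovered because the shift
  is bijective on objects.\<close>

lemma dist_tri_octahedral':
  assumes "dist_tri T U F G" "dist_tri T V G W"
  obtains E where "dist_tri T U E V" "dist_tri T E F W"
proof -
  obtain H where H: "dist_tri T F W H" "dist_tri T (Shift T U) H (Shift T V)"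
    using dist_tri_octahedral[OF dist_tri_rotate[OF assms(1)] dist_tri_rotate[OF assms(2)]] .
  obtain E where E: "E \<in> Obj T" "Shift T E = H" using Shift_surj dist_tri_Obj[OF H(1)] by blast
  have "dist_tri T E F W" using dist_tri_unrotate H(1) E by simp
  moreover have "dist_tri T U E V"
    using dist_tri_Shift_iff H(2) E dist_tri_Obj assms by metis
  ultimately show thesis using that by blast
qed

text \<open>The connecting morphism \<open>U -> V[1]\<close> vanishes, so \<open>E\<close> is a
  direct sum and its summands may be exchanged.\<close>

lemma dist_tri_swap:
  assumes "dist_tri T V E U" "orth U (Shift T V)"
  shows "dist_tri T U E V"
proof -
  obtain f g h where "(f, g, h) \<in> Tri T"
    "f \<in> hom_set T V E" "g \<in> hom_set T E U" "h \<in> hom_set T U (Shift T V)"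
    using dist_triE[OF assms(1)] .
  then have "is_direct_sum T V U E" using Tri_Zero_direct_sum orthD[OF assms(2)] by blast
  then show ?thesis using is_direct_sum_commute dist_tri_direct_sum by blast
qed

text \<open>A zero first morphism becomes a zero connecting morphism after one rotation.\<close>

lemma direct_sum_if_orth_first:
  assumes "dist_tri T A B E" "orth A B"
  shows "is_direct_sum T B (Shift T A) E"
proof -
  obtain f g h where t: "(f, g, h) \<in> Tri T"
    and h: "f \<in> hom_set T A B" "g \<in> hom_set T B E" "h \<in> hom_set T E (Shift T A)"
    using dist_triE[OF assms(1)] .
  have "f = Zero T A B" using orthD[OF assms(2) h(1)] .
  then have "Neg T (ShiftMor T f) = Zero T (Shift T A) (Shift T B)"
    using hom_Obj[OF h(1)] ShiftMor_Zero Neg_Zero Shift_Obj by simp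
  then show ?thesis
    using Tri_Zero_direct_sum[OF Tri_rotate_left[OF t] h(2,3) Neg_hom[OF ShiftMor_hom[OF h(1)]]] by blast
qed

lemma direct_sum_if_orth_second:
  assumes "dist_tri T A B E" "orth B E"
  shows "\<exists>E'. is_direct_sum T B E' A"
proof -
  obtain E' where E': "E' \<in> Obj T" "Shift T E' = E" using Shift_surj dist_tri_Obj[OF assms(1)] by blast
  have "dist_tri T E' A B" using dist_tri_unrotate assms(1) E' by simp
  then obtain f g h where t: "(f, g, h) \<in> Tri T"
    "f \<in> hom_set T E' A" "g \<in> hom_set T A B" "h \<in> hom_set T B (Shift T E')"
    by (rule dist_triE)
  then have "is_direct_sum T E' B A" using Tri_Zero_direct_sum orthD assms(2) E'(2) by blast
  then show ?thesis using is_direct_sum_commute by blast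
qed

section \<open>Additively closed and thick sets of objects\<close>

text \<open>Binary direct sums need no separate check, as a direct sum is an extension by its split
  triangle.\<close>

lemma additively_closedI:
  assumes "S \<subseteq> Obj T" "\<And>N. zero_object T N \<Longrightarrow> N \<in> S"
    and ext: "\<And>A B E. dist_tri T A B E \<Longrightarrow> A \<in> S \<Longrightarrow> E \<in> S \<Longrightarrow> B \<in> S"
    and "\<And>A B W. is_direct_sum T A B W \<Longrightarrow> W \<in> S \<Longrightarrow> A \<in> S"
  shows "additively_closed T S"
proof -
  have "closed_under_sums T S"
    unfolding closed_under_sums_def using assms(2) ext dist_tri_direct_sum by blast
  moreover have "closed_under_summands T S"
    unfolding closed_under_summands_def using assms(4) by blast
  ultimately show ?thesis
    unfolding additively_closed_def closed_under_extensions_iff using assms(1) ext by blast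
qed

lemma zero_object_Obj: "zero_object T N \<Longrightarrow> N \<in> Obj T"
  by (simp add: zero_object_def)

text \<open>An isomorphism \<open>A -> B\<close> completes to a triangle with zero third object, so
  \<open>B\<close> is an extension of zero by \<open>A\<close>.\<close>

lemma additively_closed_iso:
  assumes "additively_closed T S" "A \<in> S" "f \<in> hom_set T A B" "is_iso T f"
  shows "B \<in> S"
  using ex_zero_object dist_tri_iso[OF assms(3,4)]
    additively_closed_extension[OF assms(1) _ assms(2)] additively_closed_zero[OF assms(1)] by blast

lemma additively_closed_iso_rev:
  assumes "additively_closed T S" "B \<in> S" "f \<in> hom_set T A B" "is_iso T f"
  shows "A \<in> S"
  using is_isoE[OF assms(4,3)] additively_closed_iso[OF assms(1,2)] is_isoI assms(3) by metis

lemma additively_closed_closed_under_iso: "additively_closed T S \<Longrightarrow> closed_under_iso T S"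
  unfolding closed_under_iso_def isomorphic_def using additively_closed_iso by blast

lemma additively_closed_all: "additively_closed T (Obj T)"
proof (rule additively_closedI)
  show "B \<in> Obj T" if "dist_tri T A B E" for A B E using dist_tri_Obj(2)[OF that] .
  show "A \<in> Obj T" if "is_direct_sum T A B W" for A B W using is_direct_sum_Obj(1)[OF that] .
qed (simp_all add: zero_object_Obj)

lemma additively_closed_Inter:
  assumes "\<S> \<noteq> {}" "\<And>S. S \<in> \<S> \<Longrightarrow> additively_closed T S"
  shows "additively_closed T (\<Inter>\<S>)"
proof (rule additively_closedI)
  show "\<Inter>\<S> \<subseteq> Obj T" using assms by (auto simp: additively_closed_def)
  show "B \<in> \<Inter>\<S>" if "dist_tri T A B E" "A \<in> \<Inter>\<S>" "E \<in> \<Inter>\<S>" for A B E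
    using that(2,3) additively_closed_extension[OF assms(2) that(1)] by simp
  show "A \<in> \<Inter>\<S>" if "is_direct_sum T A B W" "W \<in> \<Inter>\<S>" for A B W
    using that(2) additively_closed_summand[OF assms(2) that(1)] by simp
  show "N \<in> \<Inter>\<S>" if "zero_object T N" for N
    using additively_closed_zero[OF assms(2) that] by simp
qed

lemma additively_closed_Int:
  "additively_closed T S \<Longrightarrow> additively_closed T S' \<Longrightarrow> additively_closed T (S \<inter> S')"
  using additively_closed_Inter[of "{S, S'}"] by auto

lemma additively_closed_hull:
  assumes "G \<subseteq> Obj T"
  shows "additively_closed T (additive_extension_hull T G)"
  unfolding additive_extension_hull_alt
  by (rule additively_closed_Inter) (use additively_closed_all assms in auto)

lemma additively_closed_orth_left:
  assumes "\<B> \<subseteq> Obj T"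
  shows "additively_closed T {A \<in> Obj T. \<forall>B \<in> \<B>. orth A B}"
proof (rule additively_closedI)
  show "N \<in> {A \<in> Obj T. \<forall>B \<in> \<B>. orth A B}" if "zero_object T N" for N
    using that assms orth_zero_object(2)[OF that] zero_object_Obj by blast
  show "W \<in> {A \<in> Obj T. \<forall>B \<in> \<B>. orth A B}"
    if "dist_tri T A W E" "A \<in> {A \<in> Obj T. \<forall>B \<in> \<B>. orth A B}" "E \<in> {A \<in> Obj T. \<forall>B \<in> \<B>. orth A B}"
    for A W E
    using that dist_tri_Obj[OF that(1)] orth_extension_left[OF that(1)] by simp
  show "A \<in> {A \<in> Obj T. \<forall>B \<in> \<B>. orth A B}"
    if "is_direct_sum T A A' W" "W \<in> {A \<in> Obj T. \<forall>B \<in> \<B>. orth A B}" for A A' W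
    using that is_direct_sum_Obj[OF that(1)] orth_summand_left[OF that(1)] by simp
qed simp

lemma additively_closed_orth_right:
  assumes "A \<in> Obj T"
  shows "additively_closed T {B \<in> Obj T. orth A B}"
proof (rule additively_closedI)
  show "N \<in> {B \<in> Obj T. orth A B}" if "zero_object T N" for N
    using that assms orth_zero_object(1)[OF that] zero_object_Obj by blast
  show "W \<in> {B \<in> Obj T. orth A B}"
    if "dist_tri T B W E" "B \<in> {B \<in> Obj T. orth A B}" "E \<in> {B \<in> Obj T. orth A B}" for B W E
    using that dist_tri_Obj[OF that(1)] orth_extension_right[OF that(1)] by simp
  show "B \<in> {B \<in> Obj T. orth A B}"
    if "is_direct_sum T B B' W" "W \<in> {B \<in> Obj T. orth A B}" for B B' W
    using that is_direct_sum_Obj[OF that(1)] orth_summand_right[OF that(1)] by simp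
qed simp

section \<open>Shifts by arbitrary integers\<close>

lemma shift_by_0 [simp]: "shift_by T 0 A = A"
  by (simp add: shift_by_def)

lemma shift_by_Obj:
  assumes "A \<in> Obj T" shows "shift_by T n A \<in> Obj T"
proof -
  have "(Shift T ^^ k) A \<in> Obj T" for k
    by (induction k) (use assms Shift_Obj in auto)
  moreover have "inv_into (Obj T) (Shift T) B \<in> Obj T" if "B \<in> Obj T" for B
    using inv_into_into[of B "Shift T" "Obj T"] Shift_bij that by (simp add: bij_betw_def)
  then have "(inv_into (Obj T) (Shift T) ^^ k) A \<in> Obj T" for k
    by (induction k) (use assms in auto)
  ultimately show ?thesis by (simp add: shift_by_def)
qed

lemma shift_by_Suc:
  assumes "A \<in> Obj T"
  shows "shift_by T (n + 1) A = Shift T (shift_by T n A)"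
proof (cases "n \<ge> 0")
  case True
  then have "nat (n + 1) = Suc (nat n)" by simp
  then show ?thesis using True by (simp add: shift_by_def)
next
  case False
  then have "nat (- n) = Suc (nat (- (n + 1)))" by simp
  \<comment> \<open>The case \<open>n = -1\<close> is separate because
    \<open>shift_by T (n + 1)\<close> then falls into the nonnegative branch of the
    definition.\<close>
  then have "shift_by T n A = inv_into (Obj T) (Shift T) (shift_by T (n + 1) A)"
    using False by (cases "n = -1") (simp_all add: shift_by_def)
  then show ?thesis
    using f_inv_into_f[of "shift_by T (n + 1) A" "Shift T" "Obj T"] Shift_bij shift_by_Obj[OF assms]
    by (simp add: bij_betw_def)
qed

lemma shift_by_1: "A \<in> Obj T \<Longrightarrow> shift_by T 1 A = Shift T A"
  using shift_by_Suc[of A 0] by simp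

lemma shift_by_pred: "A \<in> Obj T \<Longrightarrow> Shift T (shift_by T (n - 1) A) = shift_by T n A"
  using shift_by_Suc[of A "n - 1"] by simp

lemma shift_by_add:
  assumes "A \<in> Obj T"
  shows "shift_by T (m + n) A = shift_by T m (shift_by T n A)"
proof (induction m rule: int_induct[where k = 0])
  case (step1 i)
  then show ?case
    using shift_by_Suc[OF assms, of "i + n"] shift_by_Suc[OF shift_by_Obj[OF assms], of i]
    by (simp add: algebra_simps)
next
  case (step2 i)
  \<comment> \<open>Going downwards, the two sides are compared after one further shift, which is
    injective on objects.\<close>
  have "Shift T (shift_by T (i - 1 + n) A) = Shift T (shift_by T (i - 1) (shift_by T n A))"
    using step2 shift_by_pred[OF assms, of "i + n"] shift_by_pred[OF shift_by_Obj[OF assms], of i]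
    by (simp add: algebra_simps)
  then show ?case using Shift_inj shift_by_Obj assms by blast
qed simp

lemma shift_by_Shift:
  assumes "A \<in> Obj T"
  shows "shift_by T n (Shift T A) = shift_by T (n + 1) A"
  using shift_by_add[OF assms, of n 1] shift_by_1[OF assms] by simp

lemma shift_by_uminus: "A \<in> Obj T \<Longrightarrow> shift_by T (- n) (shift_by T n A) = A"
  using shift_by_add[of A "- n" n] by simp

lemma shift_by_dist_tri:
  assumes "dist_tri T A B E"
  shows "dist_tri T (shift_by T n A) (shift_by T n B) (shift_by T n E)"
proof (induction n rule: int_induct[where k = 0])
  case (step1 i)
  then show ?case
    using shift_by_Suc dist_tri_Obj[OF assms] dist_tri_Shift_iff shift_by_Obj by simp
next
  case (step2 i)
  then show ?case
    using shift_by_pred[of _ i] dist_tri_Obj[OF assms] dist_tri_Shift_iff shift_by_Obj by metis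
qed (use assms in simp)

lemma zero_object_unshift:
  assumes "zero_object T (Shift T N)" "N \<in> Obj T"
  shows "zero_object T N"
proof (rule zero_objectI[OF assms(2)])
  have "ShiftMor T (Id T N) = ShiftMor T (Zero T N N)"
    using zero_object_Id[OF assms(1)] assms(2) ShiftMor_Id ShiftMor_Zero by simp
  then show "Id T N = Zero T N N"
    using ShiftMor_inj[OF Id_hom Zero_hom] assms(2) by blast
qed

lemma shift_by_zero_object:
  assumes "zero_object T N"
  shows "zero_object T (shift_by T n N)"
proof (induction n rule: int_induct[where k = 0])
  case (step1 i)
  then show ?case using shift_by_Suc zero_object_Obj[OF assms] Shift_zero_object by simp
next
  case (step2 i)
  then show ?case
    using shift_by_pred[of _ i] zero_object_Obj[OF assms] zero_object_unshift shift_by_Obj by metis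
qed (use assms in simp)

text \<open>The shift is an automorphism, so the four structure morphisms have preimages, and the
  biproduct equations descend by injectivity on morphisms.\<close>

lemma direct_sum_unshift:
  assumes "is_direct_sum T (Shift T A) (Shift T B) (Shift T W)"
    and o: "A \<in> Obj T" "B \<in> Obj T" "W \<in> Obj T"
  shows "is_direct_sum T A B W"
proof -
  obtain f g p q where
    h: "f \<in> hom_set T (Shift T A) (Shift T W)" "g \<in> hom_set T (Shift T B) (Shift T W)"
      "p \<in> hom_set T (Shift T W) (Shift T A)" "q \<in> hom_set T (Shift T W) (Shift T B)"
    and e: "p \<cdot> f = Id T (Shift T A)" "q \<cdot> g = Id T (Shift T B)"
      "q \<cdot> f = Zero T (Shift T A) (Shift T B)" "p \<cdot> g = Zero T (Shift T B) (Shift T A)"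
      "Add T (f \<cdot> p) (g \<cdot> q) = Id T (Shift T W)"
    using assms(1) unfolding is_direct_sum_def is_biproduct_def by blast
  obtain a where a: "a \<in> hom_set T A W" "ShiftMor T a = f" using ShiftMor_full[OF o(1,3) h(1)] .
  obtain b where b: "b \<in> hom_set T B W" "ShiftMor T b = g" using ShiftMor_full[OF o(2,3) h(2)] .
  obtain c where c: "c \<in> hom_set T W A" "ShiftMor T c = p" using ShiftMor_full[OF o(3,1) h(3)] .
  obtain d where d: "d \<in> hom_set T W B" "ShiftMor T d = q" using ShiftMor_full[OF o(3,2) h(4)] .
  have "c \<cdot> a = Id T A"
    using ShiftMor_inj[OF Comp_hom[OF a(1) c(1)] Id_hom[OF o(1)]] ShiftMor_Comp[OF a(1) c(1)]
      a c e(1) ShiftMor_Id[OF o(1)] by simp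
  moreover have "d \<cdot> b = Id T B"
    using ShiftMor_inj[OF Comp_hom[OF b(1) d(1)] Id_hom[OF o(2)]] ShiftMor_Comp[OF b(1) d(1)]
      b d e(2) ShiftMor_Id[OF o(2)] by simp
  moreover have "d \<cdot> a = Zero T A B"
    using ShiftMor_inj[OF Comp_hom[OF a(1) d(1)] Zero_hom[OF o(1,2)]] ShiftMor_Comp[OF a(1) d(1)]
      a d e(3) ShiftMor_Zero[OF o(1,2)] by simp
  moreover have "c \<cdot> b = Zero T B A"
    using ShiftMor_inj[OF Comp_hom[OF b(1) c(1)] Zero_hom[OF o(2,1)]] ShiftMor_Comp[OF b(1) c(1)]
      b c e(4) ShiftMor_Zero[OF o(2,1)] by simp
  moreover have "Add T (a \<cdot> c) (b \<cdot> d) = Id T W"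
    using ShiftMor_inj[OF Add_hom[OF Comp_hom[OF c(1) a(1)] Comp_hom[OF d(1) b(1)]] Id_hom[OF o(3)]]
      ShiftMor_Add[OF Comp_hom[OF c(1) a(1)] Comp_hom[OF d(1) b(1)]]
      ShiftMor_Comp[OF c(1) a(1)] ShiftMor_Comp[OF d(1) b(1)] a b c d e(5) ShiftMor_Id[OF o(3)] by simp
  ultimately have "is_biproduct T A B W a b c d"
    unfolding is_biproduct_def using o a b c d by simp
  then show ?thesis by (auto simp: is_direct_sum_def)
qed

lemma shift_by_direct_sum:
  assumes "is_direct_sum T A B W"
  shows "is_direct_sum T (shift_by T n A) (shift_by T n B) (shift_by T n W)"
proof (induction n rule: int_induct[where k = 0])
  case (step1 i)
  then show ?case using shift_by_Suc is_direct_sum_Obj[OF assms] Shift_direct_sum by simp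
next
  case (step2 i)
  then show ?case
    using shift_by_pred[of _ i] is_direct_sum_Obj[OF assms] direct_sum_unshift shift_by_Obj by metis
qed (use assms in simp)

lemma orth_Shift:
  assumes "A \<in> Obj T" "B \<in> Obj T"
  shows "orth (Shift T A) (Shift T B) \<longleftrightarrow> orth A B"
proof
  assume o: "orth A B"
  show "orth (Shift T A) (Shift T B)"
  proof (rule orthI)
    fix f assume "f \<in> hom_set T (Shift T A) (Shift T B)"
    then obtain a where "a \<in> hom_set T A B" "ShiftMor T a = f" using ShiftMor_full assms by metis
    then show "f = Zero T (Shift T A) (Shift T B)" using orthD[OF o] ShiftMor_Zero assms by metis
  qed (use assms Shift_Obj in auto)
next
  assume o: "orth (Shift T A) (Shift T B)"
  show "orth A B"
  proof (rule orthI[OF assms])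
    fix f assume f: "f \<in> hom_set T A B"
    then have "ShiftMor T f = ShiftMor T (Zero T A B)"
      using orthD[OF o ShiftMor_hom] ShiftMor_Zero assms by simp
    then show "f = Zero T A B" using ShiftMor_inj[OF f Zero_hom[OF assms]] by blast
  qed
qed

lemma orth_shift_by:
  assumes "orth A B"
  shows "orth (shift_by T n A) (shift_by T n B)"
proof (induction n rule: int_induct[where k = 0])
  case (step1 i)
  then show ?case using shift_by_Suc orth_Obj[OF assms] orth_Shift shift_by_Obj by simp
next
  case (step2 i)
  then show ?case using shift_by_pred[of _ i] orth_Obj[OF assms] orth_Shift shift_by_Obj by metis
qed (use assms in simp)

lemma additively_closed_shift_by:
  assumes "additively_closed T S"
  shows "additively_closed T {A \<in> Obj T. shift_by T n A \<in> S}"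
proof (rule additively_closedI)
  show "N \<in> {A \<in> Obj T. shift_by T n A \<in> S}" if "zero_object T N" for N
    using that shift_by_zero_object additively_closed_zero[OF assms] zero_object_Obj by blast
  show "B \<in> {A \<in> Obj T. shift_by T n A \<in> S}"
    if "dist_tri T A B E" "A \<in> {A \<in> Obj T. shift_by T n A \<in> S}" "E \<in> {A \<in> Obj T. shift_by T n A \<in> S}"
    for A B E
    using that additively_closed_extension[OF assms shift_by_dist_tri[OF that(1)]] dist_tri_Obj by blast
  show "A \<in> {A \<in> Obj T. shift_by T n A \<in> S}"
    if "is_direct_sum T A B W" "W \<in> {A \<in> Obj T. shift_by T n A \<in> S}" for A B W
    using that additively_closed_summand[OF assms shift_by_direct_sum[OF that(1)]] is_direct_sum_Obj
    by blast
qed blast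

text \<open>One equivalence encodes closure under all integer shifts. By \<open>thick_iff\<close>
  this is the same notion as the conjunction inside \<open>thick_hull\<close>.\<close>

definition thick :: "'o set \<Rightarrow> bool" where
  "thick S \<longleftrightarrow> additively_closed T S \<and> (\<forall>A \<in> Obj T. Shift T A \<in> S \<longleftrightarrow> A \<in> S)"

lemma thick_shift_by:
  assumes "thick S" "A \<in> S"
  shows "shift_by T n A \<in> S"
proof -
  have A: "A \<in> Obj T" using assms additively_closed_Obj by (auto simp: thick_def)
  show ?thesis
  proof (induction n rule: int_induct[where k = 0])
    case (step1 i)
    then show ?case using shift_by_Suc[OF A] assms(1) shift_by_Obj[OF A] by (simp add: thick_def)
  next
    case (step2 i)
    then show ?case
      using shift_by_pred[OF A, of i] assms(1) shift_by_Obj[OF A, of "i - 1"] unfolding thick_def by metis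
  qed (use assms in simp)
qed

text \<open>After rotation \<open>E\<close> is the middle term between \<open>B\<close> and
  \<open>Shift T A\<close>, so closure under cones comes from closure under extensions and
  shifts.\<close>

lemma thick_third:
  assumes "thick S" "dist_tri T A B E" "A \<in> S" "B \<in> S"
  shows "E \<in> S"
  using additively_closed_extension[OF _ dist_tri_rotate[OF assms(2)]] assms dist_tri_Obj[OF assms(2)]
  by (simp add: thick_def)

lemma thick_iff:
  "triangulated_subcategory T S \<and> closed_under_summands T S \<and> closed_under_extensions T S \<and>
     closed_under_shifts T S \<longleftrightarrow> thick S"
proof
  assume s: "triangulated_subcategory T S \<and> closed_under_summands T S \<and> closed_under_extensions T S \<and>
     closed_under_shifts T S"
  have "A \<in> S" if "A \<in> Obj T" "Shift T A \<in> S" for A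
  proof -
    have "shift_by T (- 1) (Shift T A) \<in> S" using s that unfolding closed_under_shifts_def by blast
    then show ?thesis using shift_by_Shift[OF that(1), of "- 1"] by simp
  qed
  moreover have "Shift T A \<in> S" if "A \<in> Obj T" "A \<in> S" for A
    using s that shift_by_1[OF that(1)] unfolding closed_under_shifts_def by metis
  ultimately show "thick S"
    using s unfolding thick_def additively_closed_def triangulated_subcategory_def by blast
next
  assume t: "thick S"
  then have "closed_under_shifts T S" using thick_shift_by by (simp add: closed_under_shifts_def)
  then show "triangulated_subcategory T S \<and> closed_under_summands T S \<and> closed_under_extensions T S \<and>
     closed_under_shifts T S"
    using t thick_third[OF t] additively_closed_closed_under_iso
    unfolding thick_def additively_closed_def triangulated_subcategory_def dist_tri_def by blast
qed

lemma thick_hull_alt: "thick_hull T G = \<Inter>{S. G \<subseteq> S \<and> thick S}"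
  by (simp add: thick_hull_def thick_iff)

lemma thick_all: "thick (Obj T)"
  using additively_closed_all Shift_Obj by (simp add: thick_def)

lemma thick_hull_least: "thick S \<Longrightarrow> G \<subseteq> S \<Longrightarrow> thick_hull T G \<subseteq> S"
  by (auto simp: thick_hull_alt)

end

section \<open>The co-t-structure of a silting object\<close>

context triangulated_category
begin

definition extensions :: "'o set \<Rightarrow> 'o set \<Rightarrow> 'o set" where
  "extensions U V = {W. \<exists>A \<in> U. \<exists>B \<in> V. dist_tri T A W B}"

lemma extensionsI: "dist_tri T A W B \<Longrightarrow> A \<in> U \<Longrightarrow> B \<in> V \<Longrightarrow> W \<in> extensions U V"
  by (auto simp: extensions_def)

lemma extensions_superset:
  assumes "additively_closed T U" "additively_closed T V"
  shows "U \<subseteq> extensions U V" "V \<subseteq> extensions U V"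
proof -
  obtain N where N: "zero_object T N" using ex_zero_object by blast
  note z = additively_closed_zero[OF assms(1) N] additively_closed_zero[OF assms(2) N]
  have i: "dist_tri T A A N" if "A \<in> Obj T" for A
    using dist_tri_iso[OF Id_hom is_iso_Id N] that by blast
  show "U \<subseteq> extensions U V"
    using extensionsI[OF i _ z(2)] additively_closed_Obj[OF assms(1)] by blast
  have "dist_tri T N B B" if B: "B \<in> Obj T" for B
    using dist_triI[OF Tri_zero_Id[OF B N] Zero_hom[OF zero_object_Obj[OF N] B] Id_hom[OF B]] .
  then show "V \<subseteq> extensions U V"
    using extensionsI[OF _ z(1)] additively_closed_Obj[OF assms(2)] by blast
qed

text \<open>Writing \<open>U * V\<close> for the set of extensions, orthogonality splits the triangles in \<open>V * U\<close>,
  so that \<open>(U * V) * (U * V) = U * (V * U) * V \<subseteq> U * (U * V) * V = U * V\<close>.\<close>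

lemma extensions_extension:
  assumes U: "additively_closed T U" and V: "additively_closed T V"
    and VU: "\<And>A B. A \<in> U \<Longrightarrow> B \<in> V \<Longrightarrow> orth A (Shift T B)"
    and t: "dist_tri T E F G" and E: "E \<in> extensions U V" and G: "G \<in> extensions U V"
  shows "F \<in> extensions U V"
proof -
  obtain U1 V1 where 1: "U1 \<in> U" "V1 \<in> V" "dist_tri T U1 E V1" using E by (auto simp: extensions_def)
  obtain U2 V2 where 2: "U2 \<in> U" "V2 \<in> V" "dist_tri T U2 G V2" using G by (auto simp: extensions_def)
  obtain H where H: "dist_tri T U1 F H" "dist_tri T V1 H G" using dist_tri_octahedral[OF 1(3) t] .
  obtain E' where E': "dist_tri T V1 E' U2" "dist_tri T E' H V2"
    using dist_tri_octahedral'[OF H(2) 2(3)] .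
  have "dist_tri T U2 E' V1" using dist_tri_swap[OF E'(1) VU[OF 2(1) 1(2)]] .
  then obtain H' where H': "dist_tri T U2 H H'" "dist_tri T V1 H' V2"
    using dist_tri_octahedral E'(2) by blast
  obtain E'' where E'': "dist_tri T U1 E'' U2" "dist_tri T E'' F H'"
    using dist_tri_octahedral'[OF H(1) H'(1)] .
  show ?thesis
    using extensionsI[OF E''(2) additively_closed_extension[OF U E''(1) 1(1) 2(1)]
        additively_closed_extension[OF V H'(2) 1(2) 2(2)]] .
qed

text \<open>\<open>V\<close> stands for the already shifted class
  \<open>\<D>\<^sub>\<le>\<^sub>0[1]\<close>, hence receives only the positive shifts of
  \<open>M\<close>. The orthogonality carries one more shift because it has to kill connecting
  morphisms from \<open>U\<close> to \<open>V[1]\<close>.\<close>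

lemma generated_torsion_decomposition:
  assumes U: "additively_closed T U" and V: "additively_closed T V"
    and VU: "\<And>A B. A \<in> U \<Longrightarrow> B \<in> V \<Longrightarrow> orth A (Shift T B)"
    and M: "M \<in> Obj T" "\<And>i. i \<le> 0 \<Longrightarrow> shift_by T i M \<in> U" "\<And>i. i > 0 \<Longrightarrow> shift_by T i M \<in> V"
    and gen: "thick_hull T {M} = Obj T"
  shows "Obj T \<subseteq> extensions U V"
proof -
  let ?P = "extensions U V"
  note P = extensions_superset[OF U V]
  \<comment> \<open>Demanding all shifts makes \<open>S\<close> shift-stable; demanding that large
    shifts lie in \<open>V\<close> supplies the base of the induction for summands.\<close>
  define S where "S = {W \<in> Obj T. (\<exists>n. \<forall>k \<ge> n. shift_by T k W \<in> V) \<and> (\<forall>k. shift_by T k W \<in> ?P)}"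
  have ac: "additively_closed T S"
  proof (rule additively_closedI)
    show "S \<subseteq> Obj T" by (auto simp: S_def)
    show "N \<in> S" if N: "zero_object T N" for N
      using P(2) additively_closed_zero[OF V shift_by_zero_object[OF N]] zero_object_Obj[OF N]
      by (auto simp: S_def)
    show "B \<in> S" if t: "dist_tri T A B E" and A: "A \<in> S" and E: "E \<in> S" for A B E
    proof -
      obtain n m where n: "\<forall>k \<ge> n. shift_by T k A \<in> V" and m: "\<forall>k \<ge> m. shift_by T k E \<in> V"
        using A E by (auto simp: S_def)
      have "\<forall>k \<ge> max n m. shift_by T k B \<in> V"
        using n m additively_closed_extension[OF V shift_by_dist_tri[OF t]] by simp
      moreover have "shift_by T k B \<in> ?P" for k
        using extensions_extension[OF U V VU shift_by_dist_tri[OF t]] A E by (simp add: S_def)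
      ultimately show ?thesis using dist_tri_Obj(2)[OF t] unfolding S_def by blast
    qed
    show "A \<in> S" if s: "is_direct_sum T A B W" and W: "W \<in> S" for A B W
    proof -
      note o = is_direct_sum_Obj[OF s] and s' = is_direct_sum_commute[OF s]
      obtain n where n: "\<forall>k \<ge> n. shift_by T k W \<in> V" using W by (auto simp: S_def)
      have nA: "shift_by T k A \<in> V" and nB: "shift_by T k B \<in> V" if "k \<ge> n" for k
        using n that additively_closed_summand[OF V shift_by_direct_sum[OF s]]
          additively_closed_summand[OF V shift_by_direct_sum[OF s']] by blast+
      have step: "shift_by T k A' \<in> ?P"
        if d: "is_direct_sum T B' A' W" and B': "shift_by T (k + 1) B' \<in> ?P" for A' B' k
      proof -
        have "dist_tri T (shift_by T k W) (shift_by T k A') (shift_by T k (Shift T B'))"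
          using shift_by_dist_tri[OF dist_tri_rotate[OF dist_tri_direct_sum[OF d]]] .
        then show ?thesis
          using extensions_extension[OF U V VU] B' shift_by_Shift[OF is_direct_sum_Obj(1)[OF d]] W
          by (simp add: S_def)
      qed
      \<comment> \<open>\<open>A\<close> is an extension of \<open>W\<close> by \<open>B[1]\<close> and vice versa, so one descends from large shifts
        of both summands simultaneously.\<close>
      have "shift_by T (n - int m) A \<in> ?P \<and> shift_by T (n - int m) B \<in> ?P" for m
      proof (induction m)
        case 0
        then show ?case using nA[of n] nB[of n] P(2) by auto
      next
        case (Suc m)
        then show ?case using step[OF s', of "n - int (Suc m)"] step[OF s, of "n - int (Suc m)"]
          by (simp add: algebra_simps)
      qed
      \<comment> \<open>Every \<open>k \<le> n\<close> has the form
        \<open>n - int m\<close>.\<close>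
      then have "shift_by T k A \<in> ?P" if "k \<le> n" for k
        using that by (metis nonneg_int_cases diff_ge_0_iff_ge diff_diff_eq2 add_diff_cancel_left')
      then have "shift_by T k A \<in> ?P" for k
        using nA[of k] P(2) by (cases "k \<le> n") auto
      then show ?thesis using nA o(1) by (auto simp: S_def)
    qed
  qed
  have "Shift T W \<in> S \<longleftrightarrow> W \<in> S" if W: "W \<in> Obj T" for W
  proof -
    have "(\<exists>n. \<forall>k \<ge> n. shift_by T (k + 1) W \<in> V) \<longleftrightarrow> (\<exists>n. \<forall>k \<ge> n. shift_by T k W \<in> V)"
    proof
      assume "\<exists>n. \<forall>k \<ge> n. shift_by T (k + 1) W \<in> V"
      then obtain n where n: "\<And>k. k \<ge> n \<Longrightarrow> shift_by T (k + 1) W \<in> V" by blast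
      have "shift_by T k W \<in> V" if "k \<ge> n + 1" for k using n[of "k - 1"] that by simp
      then show "\<exists>n. \<forall>k \<ge> n. shift_by T k W \<in> V" by blast
    next
      assume "\<exists>n. \<forall>k \<ge> n. shift_by T k W \<in> V"
      then obtain n where n: "\<And>k. k \<ge> n \<Longrightarrow> shift_by T k W \<in> V" by blast
      have "shift_by T (k + 1) W \<in> V" if "k \<ge> n" for k using n[of "k + 1"] that by simp
      then show "\<exists>n. \<forall>k \<ge> n. shift_by T (k + 1) W \<in> V" by blast
    qed
    moreover have "(\<forall>k. shift_by T (k + 1) W \<in> ?P) \<longleftrightarrow> (\<forall>k. shift_by T k W \<in> ?P)"
      by (metis diff_add_cancel)
    ultimately show ?thesis using W Shift_Obj by (simp add: S_def shift_by_Shift)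
  qed
  with ac have "thick S" by (simp add: thick_def)
  moreover have "M \<in> S"
  proof -
    have "shift_by T k M \<in> V" if "k \<ge> 1" for k using M(3) that by simp
    moreover have "shift_by T k M \<in> ?P" for k
      using M(2)[of k] M(3)[of k] P by (cases "k \<le> 0") auto
    ultimately show ?thesis using M(1) unfolding S_def by blast
  qed
  ultimately have "Obj T \<subseteq> S" using thick_hull_least gen by blast
  moreover have "W \<in> ?P" if "W \<in> S" for W
  proof -
    have "shift_by T 0 W \<in> ?P" using that unfolding S_def by blast
    then show ?thesis by simp
  qed
  ultimately show ?thesis by blast
qed

end

section \<open>Orthogonality, decomposition and rigidity for the hulls of a silting object\<close>

locale silting_object = triangulated_category T
  for T :: "('o, 'm, 'z) triangulated_category_scheme" (structure) +
  fixes M :: 'o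
  assumes silting: "silting T M"
begin

definition ge0 :: "'o set" where
  "ge0 = additive_extension_hull T {shift_by T i M | i. i \<le> 0}"

definition le0 :: "'o set" where
  "le0 = additive_extension_hull T {shift_by T i M | i. i \<ge> 0}"

lemma silting_co_t_structure_eq: "silting_co_t_structure T M = (ge0, le0)"
  by (simp add: silting_co_t_structure_def ge0_def le0_def)

lemma M_Obj: "M \<in> Obj T"
  using silting by (simp add: silting_def)

lemma ge0_closed: "additively_closed T ge0" and le0_closed: "additively_closed T le0"
  unfolding ge0_def le0_def by (rule additively_closed_hull; use shift_by_Obj M_Obj in auto)+

lemma ge0_gen: "i \<le> 0 \<Longrightarrow> shift_by T i M \<in> ge0" and le0_gen: "i \<ge> 0 \<Longrightarrow> shift_by T i M \<in> le0"
  unfolding ge0_def le0_def by (rule subsetD[OF hull_incl]; auto)+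

lemma ge0_least: "additively_closed T S \<Longrightarrow> (\<And>i. i \<le> 0 \<Longrightarrow> shift_by T i M \<in> S) \<Longrightarrow> ge0 \<subseteq> S"
  and le0_least: "additively_closed T S \<Longrightarrow> (\<And>i. i \<ge> 0 \<Longrightarrow> shift_by T i M \<in> S) \<Longrightarrow> le0 \<subseteq> S"
  unfolding ge0_def le0_def by (rule hull_least; auto)+

lemma ge0_Obj: "A \<in> ge0 \<Longrightarrow> A \<in> Obj T" and le0_Obj: "A \<in> le0 \<Longrightarrow> A \<in> Obj T"
  using ge0_closed le0_closed by (auto dest: additively_closed_Obj)

text \<open>The preimage of \<open>ge0\<close> under the shift is additively closed and contains the
  generators, hence contains the hull.\<close>

lemma ge0_shift_by:
  assumes "A \<in> ge0" "i \<le> 0" shows "shift_by T i A \<in> ge0"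
proof -
  have "ge0 \<subseteq> {A \<in> Obj T. shift_by T i A \<in> ge0}"
    using ge0_least[OF additively_closed_shift_by[OF ge0_closed]] shift_by_Obj[OF M_Obj]
      ge0_gen shift_by_add[OF M_Obj, symmetric] assms(2) by simp
  then show ?thesis using assms(1) by blast
qed

lemma le0_shift_by:
  assumes "A \<in> le0" "i \<ge> 0" shows "shift_by T i A \<in> le0"
proof -
  have "le0 \<subseteq> {A \<in> Obj T. shift_by T i A \<in> le0}"
    using le0_least[OF additively_closed_shift_by[OF le0_closed]] shift_by_Obj[OF M_Obj]
      le0_gen shift_by_add[OF M_Obj, symmetric] assms(2) by simp
  then show ?thesis using assms(1) by blast
qed

lemma le0_Shift: "A \<in> le0 \<Longrightarrow> Shift T A \<in> le0"
  using le0_shift_by[of A 1] shift_by_1 le0_Obj by simp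

text \<open>Two passes from the generators to the hulls: first the second argument varies over
  \<open>le0\<close> with a generator on the left, then the first argument varies over
  \<open>ge0\<close>. Each pass uses that orthogonality to fixed objects is an additively closed
  condition.\<close>

lemma ge0_le0_orth:
  assumes "A \<in> ge0" "B \<in> le0"
  shows "orth A (Shift T B)"
proof -
  have gen: "orth (shift_by T i M) (shift_by T k (Shift T M))" if "i \<le> 0" "k \<ge> 0" for i k
  proof -
    \<comment> \<open>The degree is positive because \<open>i \<le> 0\<close> and
      \<open>k \<ge> 0\<close>; the \<open>+ 1\<close> is the shift in the conclusion.\<close>
    have "orth M (shift_by T (k - i + 1) M)" using silting that by (simp add: silting_def orth_def)
    then have "orth (shift_by T i M) (shift_by T i (shift_by T (k - i + 1) M))" by (rule orth_shift_by)
    moreover have "shift_by T i (shift_by T (k - i + 1) M) = shift_by T k (Shift T M)"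
      using shift_by_add[OF M_Obj, of i "k - i + 1"] shift_by_Shift[OF M_Obj, of k] by simp
    ultimately show ?thesis by simp
  qed
  have "orth (shift_by T i M) (Shift T B)" if i: "i \<le> 0" and B: "B \<in> le0" for i B
  proof -
    have "le0 \<subseteq> {B \<in> Obj T. shift_by T 1 B \<in> {B \<in> Obj T. orth (shift_by T i M) B}}"
    proof (rule le0_least[OF additively_closed_shift_by[OF
            additively_closed_orth_right[OF shift_by_Obj[OF M_Obj]]]])
      fix k :: int assume "k \<ge> 0"
      moreover have "shift_by T 1 (shift_by T k M) = shift_by T k (Shift T M)"
        using shift_by_add[OF M_Obj, of 1 k] shift_by_Shift[OF M_Obj, of k] by (simp add: add.commute)
      ultimately show "shift_by T k M \<in> {B \<in> Obj T. shift_by T 1 B \<in> {B \<in> Obj T. orth (shift_by T i M) B}}"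
        using gen[OF i] shift_by_Obj M_Obj Shift_Obj by simp
    qed
    then show ?thesis using B shift_by_1[OF le0_Obj[OF B]] by auto
  qed
  then have "ge0 \<subseteq> {A \<in> Obj T. \<forall>B \<in> Shift T ` le0. orth A B}"
    using ge0_least[OF additively_closed_orth_left[of "Shift T ` le0"]] Shift_Obj le0_Obj
      shift_by_Obj[OF M_Obj] by auto
  then show ?thesis using assms by auto
qed

text \<open>Turning the image into a preimage lets \<open>additively_closed_shift_by\<close> apply
  to the shifted class.\<close>

lemma Shift_le0_eq: "Shift T ` le0 = {B \<in> Obj T. shift_by T (- 1) B \<in> le0}"
proof (intro equalityI subsetI)
  fix B assume "B \<in> Shift T ` le0"
  then obtain A where A: "A \<in> le0" "B = Shift T A" by blast
  then show "B \<in> {B \<in> Obj T. shift_by T (- 1) B \<in> le0}"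
    using le0_Obj[OF A(1)] Shift_Obj shift_by_Shift[of A "- 1"] by simp
next
  fix B assume "B \<in> {B \<in> Obj T. shift_by T (- 1) B \<in> le0}"
  then have B: "B \<in> Obj T" "shift_by T (- 1) B \<in> le0" by auto
  then have "B = Shift T (shift_by T (- 1) B)" using shift_by_pred[OF B(1), of 0] by simp
  then show "B \<in> Shift T ` le0" using B(2) by blast
qed

lemma Shift_le0_closed: "additively_closed T (Shift T ` le0)"
  unfolding Shift_le0_eq by (rule additively_closed_shift_by[OF le0_closed])

lemma silting_decomposition:
  assumes "W \<in> Obj T"
  obtains A B where "A \<in> ge0" "B \<in> le0" "dist_tri T A W (Shift T B)"
proof -
  have "Obj T \<subseteq> extensions ge0 (Shift T ` le0)"
  proof (rule generated_torsion_decomposition[OF ge0_closed Shift_le0_closed])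
    \<comment> \<open>\<open>B\<close> is itself a shift of an object of \<open>le0\<close>, so this
      concerns two shifts; it reduces to one because \<open>le0\<close> is stable under
      \<open>Shift\<close>.\<close>
    show "orth A (Shift T B)" if "A \<in> ge0" "B \<in> Shift T ` le0" for A B
      using that ge0_le0_orth le0_Shift by blast
    show "shift_by T i M \<in> Shift T ` le0" if "i > 0" for i
      using that le0_gen[of "i - 1"] shift_by_pred[OF M_Obj, of i] by (metis imageI zle_diff1_eq diff_ge_0_iff_ge zless_imp_add1_zle add_0)
    show "thick_hull T {M} = Obj T" using silting by (simp add: silting_def)
  qed (use M_Obj ge0_gen in auto)
  then show thesis using that assms by (auto simp: extensions_def)
qed

lemma co_t_structure_silting: "co_t_structure T (ge0, le0)"
proof -
  have ge: "part_ge T (ge0, le0) 0 = ge0" by (simp add: part_ge_def)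
  \<comment> \<open>Index \<open>-1\<close> is a shift by \<open>+1\<close>, by the sign convention
    of \<open>part_le\<close>.\<close>
  have le: "part_le T (ge0, le0) (- 1) = Shift T ` le0"
    using le0_Obj shift_by_1 by (auto simp: part_le_def image_iff)
  have ge1: "part_ge T (ge0, le0) (- 1) = Shift T ` ge0"
    using ge0_Obj shift_by_1 by (auto simp: part_ge_def image_iff)
  have "A \<in> Shift T ` ge0" if A: "A \<in> ge0" for A
    using ge0_shift_by[OF A, of "- 1"] shift_by_pred[OF ge0_Obj[OF A], of 0] by (auto intro: rev_image_eqI)
  moreover have "torsion_pair T ge0 (Shift T ` le0)"
    unfolding torsion_pair_def
  proof (intro conjI ballI)
    show "hom_set T A B = {Zero T A B}" if "A \<in> ge0" "B \<in> Shift T ` le0" for A B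
      using that ge0_le0_orth by (auto simp: orth_def)
    show "\<exists>f g h. (f, g, h) \<in> Tri T \<and> Dom T f \<in> ge0 \<and> Cod T f = W \<and> Cod T g \<in> Shift T ` le0"
      if "W \<in> Obj T" for W
      using silting_decomposition[OF that] unfolding dist_tri_def by (metis imageI)
  qed (use ge0_closed Shift_le0_closed additively_closed_closed_under_iso in
      \<open>auto simp: additively_closed_def\<close>)
  ultimately show ?thesis unfolding co_t_structure_def ge le ge1 by blast
qed

text \<open>Decompose \<open>W\<close> in \<open>U\<close> as \<open>A -> W -> B[1]\<close>. The
  second morphism vanishes because \<open>B\<close> lies in \<open>V\<close>, so \<open>W\<close> is
  a direct summand of \<open>A\<close> and belongs to \<open>ge0\<close>. The argument for
  \<open>V\<close> is dual.\<close>

lemma silting_co_t_structure_unique: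
  assumes "ge0 \<subseteq> U" "le0 \<subseteq> V" "U \<subseteq> Obj T" "V \<subseteq> Obj T"
    and UV: "\<And>A B. A \<in> U \<Longrightarrow> B \<in> V \<Longrightarrow> orth A (Shift T B)"
  shows "U = ge0" "V = le0"
proof -
  have "W \<in> ge0" if W: "W \<in> U" for W
  proof -
    obtain A B where AB: "A \<in> ge0" "B \<in> le0" "dist_tri T A W (Shift T B)"
      using silting_decomposition W assms(3) by blast
    then have "orth W (Shift T B)" using UV[OF W] assms(2) by blast
    then obtain E where "is_direct_sum T W E A" using direct_sum_if_orth_second[OF AB(3)] by blast
    then show ?thesis using additively_closed_summand[OF ge0_closed] AB(1) by blast
  qed
  then show "U = ge0" using assms(1) by blast
  have "W \<in> le0" if W: "W \<in> V" for W
  proof -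
    have oW: "W \<in> Obj T" using W assms(4) by blast
    \<comment> \<open>Here \<open>Shift T W\<close> is decomposed, as the assumed orthogonality
      concerns shifts of objects of \<open>V\<close>; the splitting is unshifted afterwards.\<close>
    obtain A B where AB: "A \<in> ge0" "B \<in> le0" "dist_tri T A (Shift T W) (Shift T B)"
      using silting_decomposition Shift_Obj[OF oW] by blast
    then have "orth A (Shift T W)" using UV[OF _ W] assms(1) by blast
    then have "is_direct_sum T (Shift T W) (Shift T A) (Shift T B)"
      using direct_sum_if_orth_first[OF AB(3)] by blast
    then have "is_direct_sum T W A B" using direct_sum_unshift oW ge0_Obj le0_Obj AB by blast
    then show ?thesis using additively_closed_summand[OF le0_closed] AB(2) by blast
  qed
  then show "V = le0" using assms(2) by blast
qed

end

section \<open>Triangle functors and recollements\<close>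

text \<open>Precomposing with an isomorphism does not change the cone: the octahedral axiom puts the
  cone of \<open>f\<close>, which is zero, in front of the cones of \<open>g \<cdot> f\<close> and
  \<open>g\<close>. The isomorphism of \<open>Q\<close> and \<open>P\<close> is kept in the form of
  a triangle with zero first object.\<close>

lemma (in triangulated_category) dist_tri_cone_iso:
  assumes f: "f \<in> hom_set T A B" "is_iso T f" and N: "zero_object T N"
    and g: "(g, g', g'') \<in> Tri T" "g \<in> hom_set T B E" "g' \<in> hom_set T E P"
    and gf: "(g \<cdot> f, h', h'') \<in> Tri T" "h' \<in> hom_set T E Q"
  shows "dist_tri T N Q P"
proof -
  have z: "Zero T B N \<in> hom_set T B N" using Zero_hom hom_Obj f(1) zero_object_Obj[OF N] by blast
  have "Cod T f = Dom T g" using f(1) g(2) by (simp add: hom_set_def)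
  then obtain u v where "(u, v, ShiftMor T (Zero T B N) \<cdot> g'') \<in> Tri T"
    "u \<in> hom_set T (Cod T (Zero T B N)) (Cod T h')" "v \<in> hom_set T (Cod T h') (Cod T g')"
    using Tri_octahedral[OF _ Tri_iso_zero[OF f N] g(1) gf(1)] by blast
  then show ?thesis using z g(3) gf(2) dist_triI by (simp add: hom_setD)
qed

locale triangle_functor_between =
  C: triangulated_category C + D: triangulated_category D + triangle_functor C D F
  for C :: "('o1, 'm1, 'z1) triangulated_category_scheme"
    and D :: "('o2, 'm2, 'z2) triangulated_category_scheme"
    and F :: "('o1, 'm1, 'o2, 'm2, 'z3) triangle_functor_scheme"
begin

sublocale additive_functor_between C D F ..

lemma FMor_TriE:
  assumes "(f, g, h) \<in> Tri C"
  obtains h' where "(FMor F f, FMor F g, h') \<in> Tri D"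
  using FMor_Tri[OF assms] by blast

lemma FObj_dist_tri:
  assumes "dist_tri C A B E"
  shows "dist_tri D (FObj F A) (FObj F B) (FObj F E)"
proof -
  obtain f g h where t: "(f, g, h) \<in> Tri C" "f \<in> hom_set C A B" "g \<in> hom_set C B E"
    using C.dist_triE[OF assms] by metis
  show ?thesis using D.dist_triI[OF FMor_Tri[OF t(1)] FMor_hom[OF t(2)] FMor_hom[OF t(3)]] .
qed

lemma additively_closed_vimage:
  assumes "additively_closed D S"
  shows "additively_closed C {A \<in> Obj C. FObj F A \<in> S}"
proof (rule C.additively_closedI)
  show "N \<in> {A \<in> Obj C. FObj F A \<in> S}" if "zero_object C N" for N
    using that FObj_zero_object additively_closed_zero[OF assms] C.zero_object_Obj by blast
  show "B \<in> {A \<in> Obj C. FObj F A \<in> S}"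
    if "dist_tri C A B E" "A \<in> {A \<in> Obj C. FObj F A \<in> S}" "E \<in> {A \<in> Obj C. FObj F A \<in> S}" for A B E
    using that additively_closed_extension[OF assms FObj_dist_tri[OF that(1)]]
      C.dist_tri_Obj[OF that(1)] by blast
  show "A \<in> {A \<in> Obj C. FObj F A \<in> S}"
    if "is_direct_sum C A B W" "W \<in> {A \<in> Obj C. FObj F A \<in> S}" for A B W
    using that additively_closed_summand[OF assms FObj_direct_sum[OF that(1)]]
      C.is_direct_sum_Obj[OF that(1)] by blast
qed blast

text \<open>A triangle functor commutes with shifts only up to \<open>FShift\<close>, so the
  commutation is expressed as membership in a set closed under isomorphism.\<close>

lemma FObj_Shift_iff:
  assumes "additively_closed D S" "A \<in> Obj C"
  shows "FObj F (Shift C A) \<in> S \<longleftrightarrow> Shift D (FObj F A) \<in> S"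
  using D.additively_closed_iso[OF assms(1) _ FShift_hom FShift_iso]
    D.additively_closed_iso_rev[OF assms(1) _ FShift_hom FShift_iso] assms(2) by blast

text \<open>One shift at a time passes through \<open>F\<close>. The remaining outer shifts are
  absorbed by replacing \<open>S\<close> with its preimage under them, which is again additively
  closed; the object must vary in the induction.\<close>

lemma FObj_shift_by_iff:
  assumes S: "additively_closed D S" and "A \<in> Obj C"
  shows "FObj F (shift_by C n A) \<in> S \<longleftrightarrow> shift_by D n (FObj F A) \<in> S"
  using assms(2)
proof (induction n arbitrary: A rule: int_induct[where k = 0])
  case (step1 n)
  note A = step1.prems
  have "FObj F (shift_by C (n + 1) A) \<in> S \<longleftrightarrow> shift_by D n (FObj F (Shift C A)) \<in> S"
    using step1.IH[OF C.Shift_Obj[OF A]] C.shift_by_Shift[OF A] by simp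
  also have "\<dots> \<longleftrightarrow> shift_by D n (Shift D (FObj F A)) \<in> S"
    using FObj_Shift_iff[OF D.additively_closed_shift_by[OF S] A] FObj_Obj C.Shift_Obj D.Shift_Obj A
    by simp
  finally show ?case using D.shift_by_Shift FObj_Obj A by simp
next
  case (step2 n)
  obtain B where B: "B \<in> Obj C" "Shift C B = A" using C.Shift_surj step2.prems by blast
  have "FObj F (shift_by C (n - 1) A) \<in> S \<longleftrightarrow> shift_by D n (FObj F B) \<in> S"
    using step2.IH[OF B(1)] C.shift_by_Shift[OF B(1), of "n - 1"] B(2) by simp
  also have "\<dots> \<longleftrightarrow> shift_by D (n - 1) (Shift D (FObj F B)) \<in> S"
    using D.shift_by_Shift[OF FObj_Obj[OF B(1)], of "n - 1"] by simp
  also have "\<dots> \<longleftrightarrow> shift_by D (n - 1) (FObj F (Shift C B)) \<in> S"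
    using FObj_Shift_iff[OF D.additively_closed_shift_by[OF S] B(1)] FObj_Obj C.Shift_Obj D.Shift_Obj B(1)
    by simp
  finally show ?case using B(2) by simp
qed simp

lemma thick_vimage:
  assumes "D.thick S"
  shows "C.thick {A \<in> Obj C. FObj F A \<in> S}"
proof -
  have S: "additively_closed D S" using assms by (simp add: D.thick_def)
  have "FObj F (Shift C A) \<in> S \<longleftrightarrow> FObj F A \<in> S" if "A \<in> Obj C" for A
    using FObj_Shift_iff[OF S that] assms FObj_Obj[OF that] by (simp add: D.thick_def)
  then show ?thesis
    using additively_closed_vimage[OF S] C.Shift_Obj by (simp add: C.thick_def)
qed

end

section \<open>Vanishing composites, full faithfulness and generation in a recollement\<close>

context recollement
begin

sublocale iu: triangle_functor_between D Y "i_star_up R"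
  by (intro triangle_functor_between.intro i_star_up_triangle D.triangulated_category_axioms Y.triangulated_category_axioms)
sublocale i: triangle_functor_between Y D "i_star R"
  by (intro triangle_functor_between.intro i_star_triangle D.triangulated_category_axioms Y.triangulated_category_axioms)
sublocale ish: triangle_functor_between D Y "i_shriek_up R"
  by (intro triangle_functor_between.intro i_shriek_up_triangle D.triangulated_category_axioms Y.triangulated_category_axioms)
sublocale jsh: triangle_functor_between X D "j_shriek R"
  by (intro triangle_functor_between.intro j_shriek_triangle D.triangulated_category_axioms X.triangulated_category_axioms)
sublocale ju: triangle_functor_between D X "j_star_up R"
  by (intro triangle_functor_between.intro j_star_up_triangle D.triangulated_category_axioms X.triangulated_category_axioms)
sublocale jst: triangle_functor_between X D "j_star R"
  by (intro triangle_functor_between.intro j_star_triangle D.triangulated_category_axioms X.triangulated_category_axioms)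

abbreviation "iu \<equiv> FObj (i_star_up R)"
abbreviation "i \<equiv> FObj (i_star R)"
abbreviation "ish \<equiv> FObj (i_shriek_up R)"
abbreviation "jsh \<equiv> FObj (j_shriek R)"
abbreviation "ju \<equiv> FObj (j_star_up R)"
abbreviation "jst \<equiv> FObj (j_star R)"

lemma orth_iu_i: "A \<in> Obj D \<Longrightarrow> B \<in> Obj Y \<Longrightarrow> Y.orth (iu A) B \<longleftrightarrow> D.orth A (i B)"
  using adjoint_pair_orth_iff[OF adjoint1 D.additive_category_axioms Y.additive_category_axioms
      iu.additive_functor_axioms i.additive_functor_axioms] .

lemma orth_i_ish: "A \<in> Obj Y \<Longrightarrow> B \<in> Obj D \<Longrightarrow> D.orth (i A) B \<longleftrightarrow> Y.orth A (ish B)"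
  using adjoint_pair_orth_iff[OF adjoint2 Y.additive_category_axioms D.additive_category_axioms
      i.additive_functor_axioms ish.additive_functor_axioms] .

lemma orth_jsh_ju: "A \<in> Obj X \<Longrightarrow> B \<in> Obj D \<Longrightarrow> D.orth (jsh A) B \<longleftrightarrow> X.orth A (ju B)"
  using adjoint_pair_orth_iff[OF adjoint3 X.additive_category_axioms D.additive_category_axioms
      jsh.additive_functor_axioms ju.additive_functor_axioms] .

lemma orth_ju_jst: "A \<in> Obj D \<Longrightarrow> B \<in> Obj X \<Longrightarrow> X.orth (ju A) B \<longleftrightarrow> D.orth A (jst B)"
  using adjoint_pair_orth_iff[OF adjoint4 D.additive_category_axioms X.additive_category_axioms
      ju.additive_functor_axioms jst.additive_functor_axioms] .

text \<open>The condition \<open>i\<^sup>!j\<^sub>* = 0\<close>, applied at \<open>ju (i A)\<close>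
  and read through two adjunctions, says that \<open>ju (i A)\<close> has no nonzero
  endomorphism.\<close>

lemma ju_i_zero:
  assumes A: "A \<in> Obj Y"
  shows "zero_object X (ju (i A))"
proof -
  have iA: "i A \<in> Obj D" and o: "ju (i A) \<in> Obj X" "jst (ju (i A)) \<in> Obj D"
    using i.FObj_Obj ju.FObj_Obj jst.FObj_Obj A by blast+
  have "Y.orth A (ish (jst (ju (i A))))" using Y.orth_zero_object(1) i_shriek_up_j_star o A by blast
  then have "X.orth (ju (i A)) (ju (i A))" using orth_i_ish[OF A o(2)] orth_ju_jst[OF iA o(1)] by blast
  then show ?thesis using X.orthD X.Id_hom o(1) X.zero_objectI by blast
qed

lemma iu_jsh_zero:
  assumes A: "A \<in> Obj X"
  shows "zero_object Y (iu (jsh A))"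
proof -
  have jA: "jsh A \<in> Obj D" and o: "iu (jsh A) \<in> Obj Y" "i (iu (jsh A)) \<in> Obj D"
    using i.FObj_Obj jsh.FObj_Obj iu.FObj_Obj A by blast+
  have "X.orth A (ju (i (iu (jsh A))))" using X.orth_zero_object(1) ju_i_zero o A by blast
  then have "Y.orth (iu (jsh A)) (iu (jsh A))" using orth_jsh_ju[OF A o(2)] orth_iu_i[OF jA o(1)] by blast
  then show ?thesis using Y.orthD Y.Id_hom o(1) Y.zero_objectI by blast
qed

text \<open>This lemma and the next two record the isomorphisms
  \<open>i\<^sup>*i\<^sub>* \<cong> 1\<close>, \<open>i\<^sup>!i\<^sub>* \<cong> 1\<close> and
  \<open>j\<^sup>*j\<^sub>! \<cong> 1\<close> in the only form used, as membership in additively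
  closed sets.\<close>

lemma iu_i_mem:
  assumes "additively_closed Y S" "A \<in> S"
  shows "iu (i A) \<in> S"
proof -
  have A: "A \<in> Obj Y" using additively_closed_Obj assms .
  show ?thesis
    using Y.additively_closed_iso_rev[OF assms adjoint_pair.counit_hom[OF adjoint1 A]
        adjoint_pair.counit_iso[OF adjoint1 D.category_axioms Y.category_axioms i_star_ff A]] .
qed

lemma ish_i_mem:
  assumes "additively_closed Y S" "A \<in> S"
  shows "ish (i A) \<in> S"
proof -
  have A: "A \<in> Obj Y" using additively_closed_Obj assms .
  show ?thesis
    using Y.additively_closed_iso[OF assms adjoint_pair.unit_hom[OF adjoint2 A]
        adjoint_pair.unit_iso[OF adjoint2 Y.category_axioms D.category_axioms i_star_ff A]] .
qed

lemma ju_jsh_mem: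
  assumes "additively_closed X S" "A \<in> S"
  shows "ju (jsh A) \<in> S"
proof -
  have A: "A \<in> Obj X" using additively_closed_Obj assms .
  show ?thesis
    using X.additively_closed_iso[OF assms adjoint_pair.unit_hom[OF adjoint3 A]
        adjoint_pair.unit_iso[OF adjoint3 X.category_axioms D.category_axioms j_shriek_ff A]] .
qed

lemma dist_tri_j_i: "W \<in> Obj D \<Longrightarrow> dist_tri D (jsh (ju W)) W (i (iu W))"
  using triangle_j_i D.dist_triI adjoint_pair.counit_hom[OF adjoint3] adjoint_pair.unit_hom[OF adjoint1]
  by blast

text \<open>The preimage of \<open>S\<close> under \<open>i\<close> is thick and contains the
  generator, so \<open>S\<close> contains the image of \<open>i\<close>. The triangle through
  \<open>K\<close> then brings in \<open>jsh B\<close>, hence the whole image of \<open>jsh\<close>,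
  and every object is an extension of objects from these two images.\<close>

lemma thick_eq_all:
  assumes S: "D.thick S"
    and A: "A \<in> Obj Y" "thick_hull Y {A} = Obj Y" "i A \<in> S"
    and B: "B \<in> Obj X" "thick_hull X {B} = Obj X"
    and K: "dist_tri D (i E) (jsh B) K" "E \<in> Obj Y" "K \<in> S"
  shows "Obj D \<subseteq> S"
proof
  have S': "additively_closed D S" using S by (simp add: D.thick_def)
  have i: "i W \<in> S" if "W \<in> Obj Y" for W
    using Y.thick_hull_least[OF i.thick_vimage[OF S], of "{A}"] A that by auto
  have "jsh B \<in> S" using additively_closed_extension[OF S' K(1) i[OF K(2)] K(3)] .
  then have j: "jsh W \<in> S" if "W \<in> Obj X" for W
    using X.thick_hull_least[OF jsh.thick_vimage[OF S], of "{B}"] B that by auto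
  fix W assume "W \<in> Obj D"
  then show "W \<in> S"
    using additively_closed_extension[OF S' dist_tri_j_i] i j ju.FObj_Obj iu.FObj_Obj by blast
qed

text \<open>Transposing twice returns \<open>t\<close>. The second equation lets the triangle on
  \<open>t\<close> be compared with the image under \<open>ish\<close> of the triangle defining
  \<open>K\<close>.\<close>

lemma ish_adjunct_unit:
  assumes t: "t \<in> hom_set Y A (ish B)" and B: "B \<in> Obj D"
  shows "adjunct D (i_star R) (counit2 R) B t \<in> hom_set D (i A) B"
    and "FMor (i_shriek_up R) (adjunct D (i_star R) (counit2 R) B t) \<cdot>\<^bsub>Y\<^esub> unit2 R A = t"
proof -
  interpret adj: adjoint_pair Y D "i_star R" "i_shriek_up R" "unit2 R" "counit2 R" by (rule adjoint2)
  have o: "A \<in> Obj Y" "ish B \<in> Obj Y" using Y.hom_Obj t by blast+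
  note it = i.FMor_hom[OF t] and e = adj.counit_hom[OF B]
  show "adjunct D (i_star R) (counit2 R) B t \<in> hom_set D (i A) B"
    unfolding adjunct_def using D.Comp_hom[OF it e] .
  have "FMor (i_shriek_up R) (adjunct D (i_star R) (counit2 R) B t) \<cdot>\<^bsub>Y\<^esub> unit2 R A
      = FMor (i_shriek_up R) (counit2 R B)
        \<cdot>\<^bsub>Y\<^esub> (FMor (i_shriek_up R) (FMor (i_star R) t) \<cdot>\<^bsub>Y\<^esub> unit2 R A)"
    unfolding adjunct_def ish.FMor_Comp[OF it e]
    using Y.Comp_assoc[OF adj.unit_hom[OF o(1)] ish.FMor_hom[OF it] ish.FMor_hom[OF e]] .
  also have "\<dots> = FMor (i_shriek_up R) (counit2 R B) \<cdot>\<^bsub>Y\<^esub> unit2 R (ish B) \<cdot>\<^bsub>Y\<^esub> t"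
    using adj.unit_natural[OF t] Y.Comp_assoc[OF t adj.unit_hom[OF o(2)] ish.FMor_hom[OF e]] by simp
  also have "\<dots> = t" using adj.zigzag_right[OF B] Y.Comp_Id_left[OF t] by simp
  finally show "FMor (i_shriek_up R) (adjunct D (i_star R) (counit2 R) B t) \<cdot>\<^bsub>Y\<^esub> unit2 R A = t" .
qed

end

section \<open>The glued pair and the silting object that defines it\<close>

locale recollement_silting = recollement D X Y R + SX: silting_object X A + SY: silting_object Y B
  for D :: "('od, 'md) triangulated_category"
    and X :: "('ox, 'mx) triangulated_category"
    and Y :: "('oy, 'my) triangulated_category"
    and R :: "('od, 'md, 'ox, 'mx, 'oy, 'my) recollement"
    and A :: 'ox and B :: 'oy
begin

definition Dge :: "'od set" where
  "Dge = {W \<in> Obj D. ju W \<in> SX.ge0 \<and> iu W \<in> SY.ge0}"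

definition Dle :: "'od set" where
  "Dle = {W \<in> Obj D. ju W \<in> SX.le0 \<and> ish W \<in> SY.le0}"

lemma glued_eq: "glued D R (SX.ge0, SX.le0) (SY.ge0, SY.le0) = (Dge, Dle)"
  by (simp add: glued_def Dge_def Dle_def)

lemma Dge_closed: "additively_closed D Dge"
proof -
  have "Dge = {W \<in> Obj D. ju W \<in> SX.ge0} \<inter> {W \<in> Obj D. iu W \<in> SY.ge0}" by (auto simp: Dge_def)
  then show ?thesis
    using D.additively_closed_Int[OF ju.additively_closed_vimage[OF SX.ge0_closed]
        iu.additively_closed_vimage[OF SY.ge0_closed]] by simp
qed

lemma Dle_closed: "additively_closed D Dle"
proof -
  have "Dle = {W \<in> Obj D. ju W \<in> SX.le0} \<inter> {W \<in> Obj D. ish W \<in> SY.le0}" by (auto simp: Dle_def)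
  then show ?thesis
    using D.additively_closed_Int[OF ju.additively_closed_vimage[OF SX.le0_closed]
        ish.additively_closed_vimage[OF SY.le0_closed]] by simp
qed

lemma Dge_shift_by: "W \<in> Dge \<Longrightarrow> n \<le> 0 \<Longrightarrow> shift_by D n W \<in> Dge"
  using ju.FObj_shift_by_iff[OF SX.ge0_closed] iu.FObj_shift_by_iff[OF SY.ge0_closed]
    SX.ge0_shift_by SY.ge0_shift_by D.shift_by_Obj by (simp add: Dge_def)

lemma Dle_shift_by: "W \<in> Dle \<Longrightarrow> n \<ge> 0 \<Longrightarrow> shift_by D n W \<in> Dle"
  using ju.FObj_shift_by_iff[OF SX.le0_closed] ish.FObj_shift_by_iff[OF SY.le0_closed]
    SX.le0_shift_by SY.le0_shift_by D.shift_by_Obj by (simp add: Dle_def)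

text \<open>\<open>V\<close> is an extension of \<open>jsh (ju V)\<close> and
  \<open>i (iu V)\<close>. Adjunction reduces orthogonality of these two to the known orthogonality
  in \<open>X\<close> and in \<open>Y\<close>, which is why the glued classes use \<open>iu\<close>
  on one side and \<open>ish\<close> on the other.\<close>

lemma Dge_Dle_orth:
  assumes V: "V \<in> Dge" and W: "W \<in> Dle"
  shows "D.orth V (Shift D W)"
proof -
  have o: "V \<in> Obj D" "W \<in> Obj D" "Shift D W \<in> Obj D"
    using V W D.Shift_Obj by (auto simp: Dge_def Dle_def)
  have "ju (Shift D W) \<in> Shift X ` SX.le0"
    using ju.FObj_Shift_iff[OF SX.Shift_le0_closed o(2)] W by (simp add: Dle_def)
  then have "X.orth (ju V) (ju (Shift D W))" using V SX.ge0_le0_orth by (auto simp: Dge_def)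
  then have 1: "D.orth (jsh (ju V)) (Shift D W)"
    using orth_jsh_ju[OF ju.FObj_Obj[OF o(1)] o(3)] by blast
  have "ish (Shift D W) \<in> Shift Y ` SY.le0"
    using ish.FObj_Shift_iff[OF SY.Shift_le0_closed o(2)] W by (simp add: Dle_def)
  then have "Y.orth (iu V) (ish (Shift D W))" using V SY.ge0_le0_orth by (auto simp: Dge_def)
  then have 2: "D.orth (i (iu V)) (Shift D W)"
    using orth_i_ish[OF iu.FObj_Obj[OF o(1)] o(3)] by blast
  show ?thesis using D.orth_extension_left[OF dist_tri_j_i[OF o(1)] 1 2] .
qed

lemma silting_generator_mem: "A \<in> SX.ge0" "A \<in> SX.le0" "B \<in> SY.ge0" "B \<in> SY.le0"
  using SX.ge0_gen[of 0] SX.le0_gen[of 0] SY.ge0_gen[of 0] SY.le0_gen[of 0] by simp_all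

lemma i_mem_glued: "i B \<in> Dge" "i B \<in> Dle"
proof -
  have "ju (i B) \<in> SX.ge0" "ju (i B) \<in> SX.le0"
    using additively_closed_zero[OF SX.ge0_closed] additively_closed_zero[OF SX.le0_closed]
      ju_i_zero[OF SY.M_Obj] by simp_all
  then show "i B \<in> Dge" "i B \<in> Dle"
    using iu_i_mem[OF SY.ge0_closed] ish_i_mem[OF SY.le0_closed] silting_generator_mem
      i.FObj_Obj[OF SY.M_Obj] by (simp_all add: Dge_def Dle_def)
qed

text \<open>Apply the three functors to the triangle defining \<open>K\<close>. Under
  \<open>ju\<close> the term \<open>i E\<close> dies and the silting object \<open>A\<close> of
  \<open>X\<close> remains; under \<open>iu\<close> the term \<open>jsh A\<close> dies and a copy of
  \<open>E[1]\<close> remains; under \<open>ish\<close> one finds the third object of the chosen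
  truncation triangle.\<close>

lemma truncated_cone_mem_glued:
  assumes trunc: "truncation_triangle Y (SY.ge0, SY.le0) 1 (ish (jsh A)) t g h"
    and K: "(adjunct D (i_star R) (counit2 R) (jsh A) t, p, q) \<in> Tri D" "Cod D p = K"
  shows "\<exists>E \<in> Obj Y. dist_tri D (i E) (jsh A) K" "K \<in> Dge" "K \<in> Dle"
proof -
  define E where "E = Dom Y t"
  let ?a = "adjunct D (i_star R) (counit2 R) (jsh A) t"
  \<comment> \<open>Truncation at index 1 puts \<open>E\<close> into \<open>SY.ge0\<close> shifted
    by \<open>-1\<close>, while the other part has index 0, so it is \<open>SY.le0\<close>
    itself.\<close>
  have tri: "(t, g, h) \<in> Tri Y" and c: "Cod Y t = ish (jsh A)" "Cod Y g \<in> SY.le0"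
    and E: "E \<in> shift_by Y (- 1) ` SY.ge0"
    using trunc by (auto simp: truncation_triangle_def part_ge_def part_le_def E_def)
  note t = Y.Tri_hom(1,2)[OF tri E_def[symmetric] c(1) refl]
  have jA: "jsh A \<in> Obj D" using jsh.FObj_Obj SX.M_Obj .
  note a = ish_adjunct_unit[OF t(1) jA]
  note p = D.Tri_hom(2)[OF K(1) hom_setD(2,3)[OF a(1)] K(2)]
  have oE: "E \<in> Obj Y" and oK: "K \<in> Obj D" using Y.hom_Obj[OF t(1)] D.hom_Obj[OF p] by blast+
  obtain W where W: "W \<in> SY.ge0" "E = shift_by Y (- 1) W" using E by blast
  then have SE: "shift_by Y 1 E \<in> SY.ge0"
    using Y.shift_by_uminus[OF SY.ge0_Obj[OF W(1)], of "- 1"] by simp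
  have d: "dist_tri D (i E) (jsh A) K" using D.dist_triI[OF K(1) a(1) p] .
  then show "\<exists>E \<in> Obj Y. dist_tri D (i E) (jsh A) K" using oE by blast
  have dju: "dist_tri X (ju (jsh A)) (ju K) (Shift X (ju (i E)))"
    using X.dist_tri_rotate[OF ju.FObj_dist_tri[OF d]] .
  have z: "zero_object X (Shift X (ju (i E)))" using X.Shift_zero_object ju_i_zero oE by blast
  \<comment> \<open>Kept general in \<open>S\<close>, because it serves both for
    \<open>SX.ge0\<close> and for \<open>SX.le0\<close>.\<close>
  have ju: "ju K \<in> S" if S: "additively_closed X S" "A \<in> S" for S
    using additively_closed_extension[OF S(1) dju] ju_jsh_mem[OF S] additively_closed_zero[OF S(1) z] .
  \<comment> \<open>The condition on \<open>E[1]\<close> is stated as an additively closed condition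
    on \<open>E\<close>, so that it can be transported to \<open>iu (i E)\<close>.\<close>
  have "E \<in> {W \<in> Obj Y. shift_by Y 1 W \<in> SY.ge0}" using oE SE by blast
  then have "iu (i E) \<in> {W \<in> Obj Y. shift_by Y 1 W \<in> SY.ge0}"
    using iu_i_mem[OF Y.additively_closed_shift_by[OF SY.ge0_closed]] by blast
  then have "Shift Y (iu (i E)) \<in> SY.ge0" using Y.shift_by_1 by auto
  then have "iu K \<in> SY.ge0"
    using additively_closed_extension[OF SY.ge0_closed Y.dist_tri_rotate[OF iu.FObj_dist_tri[OF d]]]
      additively_closed_zero[OF SY.ge0_closed iu_jsh_zero[OF SX.M_Obj]] by blast
  then show "K \<in> Dge"
    using ju[OF SX.ge0_closed silting_generator_mem(1)] oK by (simp add: Dge_def)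
  obtain N where N: "zero_object Y N" using Y.ex_zero_object by blast
  obtain r where r: "(FMor (i_shriek_up R) ?a, FMor (i_shriek_up R) p, r) \<in> Tri Y"
    using ish.FMor_TriE[OF K(1)] .
  \<comment> \<open>The first morphism \<open>t\<close> of the truncation triangle is rewritten as a
    composite with the unit, which is an isomorphism since \<open>i\<close> is fully faithful. Its
    cone is therefore that of \<open>ish\<close> applied to the adjunct, namely
    \<open>ish K\<close>.\<close>
  have tri': "(FMor (i_shriek_up R) ?a \<cdot>\<^bsub>Y\<^esub> unit2 R E, g, h) \<in> Tri Y" using tri a(2) by simp
  have "dist_tri Y N (Cod Y g) (ish K)"
    using Y.dist_tri_cone_iso[OF adjoint_pair.unit_hom[OF adjoint2 oE]
        adjoint_pair.unit_iso[OF adjoint2 Y.category_axioms D.category_axioms i_star_ff oE] N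
        r ish.FMor_hom[OF a(1)] ish.FMor_hom[OF p] tri' t(2)] .
  \<comment> \<open>One rotation makes \<open>ish K\<close> the middle term between the truncation
    and a zero object.\<close>
  then have "ish K \<in> SY.le0"
    using additively_closed_extension[OF SY.le0_closed Y.dist_tri_rotate c(2)]
      additively_closed_zero[OF SY.le0_closed Y.Shift_zero_object[OF N]] by blast
  then show "K \<in> Dle"
    using ju[OF SX.le0_closed silting_generator_mem(2)] oK by (simp add: Dle_def)
qed

lemma silting_glued:
  assumes trunc: "truncation_triangle Y (SY.ge0, SY.le0) 1 (ish (jsh A)) t g h"
    and K: "(adjunct D (i_star R) (counit2 R) (jsh A) t, p, q) \<in> Tri D" "Cod D p = K"
    and Z: "is_direct_sum D (i B) K Z"
  shows "silting D Z"
    and "co_t_structure D (glued D R (SX.ge0, SX.le0) (SY.ge0, SY.le0))"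
    and "silting_co_t_structure D Z = glued D R (SX.ge0, SX.le0) (SY.ge0, SY.le0)"
proof -
  note KD = truncated_cone_mem_glued[OF trunc K]
  have ZD: "Z \<in> Dge" "Z \<in> Dle"
    using additively_closed_sum[OF Dge_closed Z i_mem_glued(1) KD(2)]
      additively_closed_sum[OF Dle_closed Z i_mem_glued(2) KD(3)] by simp_all
  have oZ: "Z \<in> Obj D" using ZD(1) by (simp add: Dge_def)
  \<comment> \<open>Write \<open>Z[n]\<close> as the shift of \<open>Z[n - 1]\<close>, which stays
    in \<open>Dle\<close> because \<open>n - 1 \<ge> 0\<close>.\<close>
  have "hom_set D Z (shift_by D n Z) = {Zero D Z (shift_by D n Z)}" if "n > 0" for n
    using Dge_Dle_orth[OF ZD(1) Dle_shift_by[OF ZD(2), of "n - 1"]] that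
      D.shift_by_pred[OF oZ, of n] by (simp add: D.orth_def)
  moreover have "thick_hull D {Z} = Obj D"
  proof
    show "thick_hull D {Z} \<subseteq> Obj D" using D.thick_hull_least[OF D.thick_all] oZ by blast
    have "Obj D \<subseteq> S" if S: "Z \<in> S" "D.thick S" for S
    proof -
      obtain E where E: "E \<in> Obj Y" "dist_tri D (i E) (jsh A) K" using KD(1) by blast
      have S': "additively_closed D S" using S(2) by (simp add: D.thick_def)
      have "thick_hull Y {B} = Obj Y" "thick_hull X {A} = Obj X"
        using SX.silting SY.silting by (simp_all add: silting_def)
      then show ?thesis
        using thick_eq_all[OF S(2) SY.M_Obj _ additively_closed_summand[OF S' Z S(1)] SX.M_Obj _
          E(2,1) additively_closed_summand[OF S' D.is_direct_sum_commute[OF Z] S(1)]] by blast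
    qed
    then show "Obj D \<subseteq> thick_hull D {Z}" by (auto simp: D.thick_hull_alt)
  qed
  ultimately show silt: "silting D Z" using oZ by (simp add: silting_def)
  interpret SD: silting_object D Z by unfold_locales (rule silt)
  \<comment> \<open>The glued classes contain the respective shifts of \<open>Z\<close>, hence the
    hulls \<open>SD.ge0\<close> and \<open>SD.le0\<close>; being orthogonal, they cannot be
    larger.\<close>
  have "Dge = SD.ge0" "Dle = SD.le0"
    using SD.silting_co_t_structure_unique[of Dge Dle]
      SD.ge0_least[OF Dge_closed Dge_shift_by[OF ZD(1)]] SD.le0_least[OF Dle_closed Dle_shift_by[OF ZD(2)]]
      Dge_Dle_orth by (auto simp: Dge_def Dle_def)
  then show "co_t_structure D (glued D R (SX.ge0, SX.le0) (SY.ge0, SY.le0))"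
    and "silting_co_t_structure D Z = glued D R (SX.ge0, SX.le0) (SY.ge0, SY.le0)"
    using SD.co_t_structure_silting SD.silting_co_t_structure_eq by (simp_all add: glued_eq)
qed

end

theorem theorem3p1:
  fixes \<D> :: "('od, 'md) triangulated_category"
    and \<X> :: "('ox, 'mx) triangulated_category"
    and \<Y> :: "('oy, 'my) triangulated_category"
    and \<R> :: "('od, 'md, 'ox, 'mx, 'oy, 'my) recollement"
    and X :: 'ox and Y :: 'oy and K Z :: 'od
    and t g h :: 'my and p q :: 'md
  assumes "triangulated_category \<D>" "triangulated_category \<X>" "triangulated_category \<Y>"
    and "recollement \<D> \<X> \<Y> \<R>"
    and "silting \<X> X" and "silting \<Y> Y"
    and "PX = silting_co_t_structure \<X> X" and "PY = silting_co_t_structure \<Y> Y"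
    and "truncation_triangle \<Y> PY 1 (FObj (i_shriek_up \<R>) (FObj (j_shriek \<R>) X)) t g h"
    and "(adjunct \<D> (i_star \<R>) (counit2 \<R>) (FObj (j_shriek \<R>) X) t, p, q) \<in> Tri \<D>"
    and "Cod \<D> p = K"
    and "is_direct_sum \<D> (FObj (i_star \<R>) Y) K Z"
  shows "silting \<D> Z \<and>
    co_t_structure \<D> (glued \<D> \<R> PX PY) \<and>
    silting_co_t_structure \<D> Z = glued \<D> \<R> PX PY"
proof -
  interpret recollement_silting \<D> \<X> \<Y> \<R> X Y
    using assms(2-6)
    by (auto intro!: recollement_silting.intro silting_object.intro silting_object_axioms.intro)
  note PX = SX.silting_co_t_structure_eq[folded assms(7)]
    and PY = SY.silting_co_t_structure_eq[folded assms(8)]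
  show ?thesis
    using silting_glued[OF assms(9)[unfolded PY] assms(10-12)] unfolding PX PY by blast
qed

end
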